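(* Let $k\ge 1$ and let $s_1,\ldots,s_k$ be positive integers. Then $$\mathrm{forb}(m,\{1_{k,2},\,I_{s_1}\times\cdots\times I_{s_k}\})=\binom m0+\cdots+\binom m{k-1}+ex^{(k)}(m,K(s_1,\ldots,s_k)).$$ In particular, $$\mathrm{forb}(m,\{1_{2,2},F_{11}\})=1+m+ex(m,K_{2,2})=\Theta(m^{3/2})\quad (m\to\infty).$$
   Context: A matrix is simple if it is a $(0,1)$-matrix with no repeated columns. $F\prec A$ means that some submatrix of $A$ is a row and column permutation of $F$. For a family $\mathcal F$ of $(0,1)$-matrices, $\mathrm{forb}(m,\mathcal F)$ is the maximum number of columns of an $m$-rowed simple matrix $A$ with $F\nprec A$ for all $F\in\mathcal F$. $1_{k,2}$ is the $k\times 2$ matrix with all entries $1$ and $I_s$ the $s\times s$ identity matrix. $A_1\times\cdots\times A_p$ is the matrix whose columns are all combinations obtained by placing a column of $A_1$ on top of a column of $A_2$, on top of a column of $A_3$, etc. $K(s_1,\ldots,s_k)$ is the complete $k$-partite $k$-uniform hypergraph with partite sets of sizes $s_1,\ldots,s_k$ (edges are all sets with exactly one vertex in each partite set). $ex^{(k)}(m,\mathcal H)$ is the largest number of edges of a $k$-uniform hypergraph (no repeated edges) on $m$ vertices with no subhypergraph isomorphic to $\mathcal H$; $ex(m,G)$ is the graph version, and $K_{2,2}$ is the complete bipartite graph with parts of size $2$. Finally $$F_{11}=I_2\times I_2=\begin{bmatrix}1&0&1&0\\1&0&0&1\\0&1&1&0\\0&1&0&1\end{bmatrix}$$ (equality up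 to row and column permutations). *)

theory Defs
  imports
    Jordan_Normal_Form.DL_Submatrix
    "HOL-Combinatorics.Permutations"
    "HOL-Library.Landau_Symbols"
begin

section \<open>Forbidden configurations\<close>

definition simple_mat :: "nat mat \<Rightarrow> bool" where
  "simple_mat A \<longleftrightarrow> elements_mat A \<subseteq> {0, 1} \<and> distinct (cols A)"

definition perm_equiv_mat :: "'a mat \<Rightarrow> 'a mat \<Rightarrow> bool" where
  "perm_equiv_mat B F \<longleftrightarrow>
     (\<exists>p q. p permutes {..<dim_row F} \<and> q permutes {..<dim_col F} \<and>
        B = mat (dim_row F) (dim_col F) (\<lambda>(i, j). F $$ (p i, q j)))"

definition config :: "'a mat \<Rightarrow> 'a mat \<Rightarrow> bool" (infix \<open>\<prec>\<close> 50) where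
  "F \<prec> A \<longleftrightarrow>
     (\<exists>I J. I \<subseteq> {..<dim_row A} \<and> J \<subseteq> {..<dim_col A} \<and> perm_equiv_mat (submatrix A I J) F)"

text \<open>The maximum is over a finite set, because a simple matrix with \<open>m\<close> rows has at most
  \<open>2 ^ m\<close> columns; the set contains \<open>0\<close> whenever all members of the family have a column.\<close>

definition forb :: "nat \<Rightarrow> nat mat set \<Rightarrow> nat" where
  "forb m \<F> = Max {dim_col A | A. dim_row A = m \<and> simple_mat A \<and> (\<forall>F\<in>\<F>. \<not> F \<prec> A)}"

definition ones_mat :: "nat \<Rightarrow> nat \<Rightarrow> nat mat" where
  "ones_mat k l = mat k l (\<lambda>_. 1)"

text \<open>Column \<open>a * dim_col B + b\<close> of the product is column \<open>a\<close> of \<open>A\<close> on top of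
  column \<open>b\<close> of \<open>B\<close>.\<close>

definition prod_mat :: "'a mat \<Rightarrow> 'a mat \<Rightarrow> 'a mat" where
  "prod_mat A B = mat (dim_row A + dim_row B) (dim_col A * dim_col B)
     (\<lambda>(i, j). if i < dim_row A then A $$ (i, j div dim_col B)
                else B $$ (i - dim_row A, j mod dim_col B))"

text \<open>The matrix with no rows and one column is neutral for the product.\<close>

definition prod_mats :: "'a mat list \<Rightarrow> 'a mat" where
  "prod_mats As = foldr prod_mat As (mat 0 1 (\<lambda>_. undefined))"

definition F11 :: "nat mat" where
  "F11 = mat_of_rows_list 4
     [[1, 0, 1, 0],
      [1, 0, 0, 1],
      [0, 1, 1, 0],
      [0, 1, 0, 1]]"

lemma F11_perm_equiv: "perm_equiv_mat F11 (prod_mats [1\<^sub>m 2, 1\<^sub>m 2])"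
proof -
  define p :: "nat \<Rightarrow> nat" where "p = id(1 := 2, 2 := 3, 3 := 1)"
  define q :: "nat \<Rightarrow> nat" where "q = id(1 := 3, 2 := 1, 3 := 2)"
  have set4: "{..<4::nat} = {0, 1, 2, 3}"
    by auto
  have p: "p permutes {..<4}"
    by (rule bij_imp_permutes) (auto simp: set4 p_def bij_betw_def inj_on_def)
  have q: "q permutes {..<4}"
    by (rule bij_imp_permutes) (auto simp: set4 q_def bij_betw_def inj_on_def)
  have dims: "dim_row (prod_mats [1\<^sub>m 2, 1\<^sub>m 2 :: nat mat]) = 4"
    "dim_col (prod_mats [1\<^sub>m 2, 1\<^sub>m 2 :: nat mat]) = 4"
    by (simp_all add: prod_mats_def prod_mat_def)
  have "F11 = mat 4 4 (\<lambda>(i, j). prod_mats [1\<^sub>m 2, 1\<^sub>m 2] $$ (p i, q j))"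
  proof (rule eq_matI)
    fix i j :: nat
    assume "i < dim_row (mat 4 4 (\<lambda>(i, j). prod_mats [1\<^sub>m 2, 1\<^sub>m 2 :: nat mat] $$ (p i, q j)))"
      and "j < dim_col (mat 4 4 (\<lambda>(i, j). prod_mats [1\<^sub>m 2, 1\<^sub>m 2 :: nat mat] $$ (p i, q j)))"
    then have "i \<in> {0, 1, 2, 3}" "j \<in> {0, 1, 2, 3}"
      by auto
    then show "F11 $$ (i, j) = mat 4 4 (\<lambda>(i, j). prod_mats [1\<^sub>m 2, 1\<^sub>m 2] $$ (p i, q j)) $$ (i, j)"
      by (auto simp: F11_def mat_of_rows_list_def prod_mats_def prod_mat_def p_def q_def)
  qed (simp_all add: F11_def mat_of_rows_list_def)
  with p q show ?thesis
    unfolding perm_equiv_mat_def dims by blast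
qed

section \<open>Hypergraphs\<close>

text \<open>A hypergraph is given by its vertex set and its edge set. Graphs are the 2-uniform
  hypergraphs.\<close>

type_synonym 'a hypergraph = "'a set \<times> 'a set set"

definition hypergraph :: "'a hypergraph \<Rightarrow> bool" where
  "hypergraph G \<longleftrightarrow> (\<forall>e\<in>snd G. e \<subseteq> fst G)"

definition uniform :: "nat \<Rightarrow> 'a hypergraph \<Rightarrow> bool" where
  "uniform k G \<longleftrightarrow> (\<forall>e\<in>snd G. finite e \<and> card e = k)"

definition subhypergraph :: "'a hypergraph \<Rightarrow> 'a hypergraph \<Rightarrow> bool" where
  "subhypergraph H G \<longleftrightarrow> hypergraph H \<and> fst H \<subseteq> fst G \<and> snd H \<subseteq> snd G"

definition isomorphic :: "'a hypergraph \<Rightarrow> 'b hypergraph \<Rightarrow> bool" where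
  "isomorphic G H \<longleftrightarrow>
     (\<exists>f. bij_betw f (fst G) (fst H) \<and> snd H = (\<lambda>e. f ` e) ` snd G)"

text \<open>The maximum is over a finite set, which contains \<open>0\<close> whenever \<open>H\<close> has an edge.\<close>

definition ex :: "nat \<Rightarrow> nat \<Rightarrow> 'b hypergraph \<Rightarrow> nat" where
  "ex k m H = Max {card (snd G) | G :: nat hypergraph.
     fst G = {..<m} \<and> hypergraph G \<and> uniform k G \<and>
     \<not> (\<exists>G'. subhypergraph G' G \<and> isomorphic H G')}"

abbreviation ex_graph :: "nat \<Rightarrow> 'b hypergraph \<Rightarrow> nat" where
  "ex_graph m G \<equiv> ex 2 m G"

text \<open>The vertex \<open>(i, j)\<close> is the \<open>j\<close>-th vertex of the \<open>i\<close>-th partite set.\<close>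

definition complete_partite :: "nat list \<Rightarrow> (nat \<times> nat) hypergraph" where
  "complete_partite s =
     (let V = (SIGMA i:{..<length s}. {..<s ! i})
      in (V, {e. e \<subseteq> V \<and> (\<forall>i<length s. \<exists>!v. v \<in> e \<and> fst v = i)}))"

definition complete_bipartite :: "nat \<Rightarrow> nat \<Rightarrow> (nat + nat) hypergraph" where
  "complete_bipartite a b =
     ({..<a} <+> {..<b}, {{Inl i, Inr j} | i j. i < a \<and> j < b})"

end

theory Submission
  imports Defs
    "HOL-Algebra.Algebraic_Closure_Type"
    "HOL-Analysis.Convex"
    "HOL-Library.Z2"
begin

text \<open>Read the columns of a simple matrix as subsets of the row set. Avoiding \<open>1\<^bsub>k,2\<^esub>\<close> means that
  distinct sets share fewer than \<open>k\<close> elements. All sets with fewer than \<open>k\<close> elements together with the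
  edges of an extremal hypergraph therefore form an admissible family. Conversely, replace every set of
  size at least \<open>k\<close> by one of its \<open>k\<close>-subsets; different sets receive different subsets. If these
  subsets contained a copy of \<open>K(s\<^sub>1,\<dots>,s\<^sub>k)\<close>, a set \<open>S\<close> whose chosen subset is the edge \<open>e\<close> could not
  contain another vertex \<open>v\<close> of the copy: exchanging a vertex of \<open>e\<close> for \<open>v\<close> gives a second edge inside
  \<open>S\<close>, which is the chosen subset of some \<open>T\<close> with \<open>\<bar>S \<inter> T\<bar> \<ge> k\<close>, so \<open>S = T\<close>, a contradiction. Hence the
  traces on the copy are exactly the edges, and the forbidden product of identity matrices appears.

  The order of magnitude of \<open>ex(m, K\<^bsub>2,2\<^esub>)\<close> follows from the double counting of Kovari, Sos and
  Turan and from polarity graphs over the fields with \<open>2 ^ n\<close> elements. Powers of \<open>2\<close> are dense enough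
  to cover all \<open>m\<close> up to a constant factor.\<close>

section \<open>Configurations as traces of set systems\<close>

lemma bij_betw_pick:
  assumes "finite I"
  shows "bij_betw (pick I) {..<card I} I"
proof -
  have "inj_on (pick I) {..<card I}"
    by (rule linorder_inj_onI') (use pick_mono in \<open>force simp: less_le\<close>)
  moreover have "pick I ` {..<card I} \<subseteq> I"
    using pick_in_set by auto
  ultimately show ?thesis
    by (metis assms bij_betw_def card_image card_lessThan card_subset_eq)
qed

text \<open>\<open>submatrix\<close> lists the selected indices in increasing order. The permutation
  \<open>p\<close> sorts an arbitrary injective selection into that order.\<close>

lemma exists_permutation_pick:
  assumes "inj_on f {..<n::nat}" "I = f ` {..<n}"
  obtains p where "p permutes {..<n}" "\<And>i. i < n \<Longrightarrow> f (p i) = pick I i"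
proof -
  have card: "card I = n" and fin: "finite I"
    using assms by (auto simp: card_image)
  have f: "bij_betw f {..<n} I"
    using assms by (simp add: bij_betw_def)
  define p where "p i = (if i < n then inv_into {..<n} f (pick I i) else i)" for i
  have "bij_betw (inv_into {..<n} f \<circ> pick I) {..<n} {..<n}"
    using bij_betw_trans[OF _ bij_betw_inv_into[OF f]] bij_betw_pick[OF fin] card by blast
  then have "bij_betw p {..<n} {..<n}"
    by (rule bij_betw_cong[THEN iffD1, rotated]) (simp add: p_def)
  then have "p permutes {..<n}"
    by (rule bij_imp_permutes) (simp add: p_def)
  moreover have "f (p i) = pick I i" if "i < n" for i
    using bij_betw_inv_into_right[OF f] bij_betwE[OF bij_betw_pick[OF fin]] that card
    by (simp add: p_def)
  ultimately show thesis
    using that by blast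
qed

text \<open>Choosing an index set and permuting it amounts to a single injection: compose
  \<open>pick\<close> with the inverse permutation, or conversely sort the values of the injection.
  Later arguments then never meet \<open>submatrix\<close>.\<close>

lemma config_iff:
  "F \<prec> A \<longleftrightarrow>
     (\<exists>f g. inj_on f {..<dim_row F} \<and> f ` {..<dim_row F} \<subseteq> {..<dim_row A} \<and>
        inj_on g {..<dim_col F} \<and> g ` {..<dim_col F} \<subseteq> {..<dim_col A} \<and>
        (\<forall>i<dim_row F. \<forall>j<dim_col F. F $$ (i, j) = A $$ (f i, g j)))" (is "_ \<longleftrightarrow> ?R")
proof
  assume "F \<prec> A"
  then obtain I J p q where IJ: "I \<subseteq> {..<dim_row A}" "J \<subseteq> {..<dim_col A}"
    and p: "p permutes {..<dim_row F}" and q: "q permutes {..<dim_col F}"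
    and eq: "submatrix A I J = mat (dim_row F) (dim_col F) (\<lambda>(i, j). F $$ (p i, q j))"
    unfolding config_def perm_equiv_mat_def by blast
  have sets: "{i. i < dim_row A \<and> i \<in> I} = I" "{j. j < dim_col A \<and> j \<in> J} = J"
    using IJ by auto
  have card: "card I = dim_row F" "card J = dim_col F"
    using arg_cong[OF eq, of dim_row] arg_cong[OF eq, of dim_col]
    by (simp_all add: dim_submatrix sets)
  have bij: "bij_betw (pick I \<circ> inv_into UNIV p) {..<dim_row F} I" "bij_betw (pick J \<circ> inv_into UNIV q) {..<dim_col F} J"
    using bij_betw_trans[OF permutes_imp_bij[OF permutes_inv[OF p]], of "pick I" I]
      bij_betw_trans[OF permutes_imp_bij[OF permutes_inv[OF q]], of "pick J" J]
      bij_betw_pick[OF finite_subset[OF IJ(1)]] bij_betw_pick[OF finite_subset[OF IJ(2)]]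
    by (simp_all add: card)
  have "F $$ (i, j) = A $$ ((pick I \<circ> inv_into UNIV p) i, (pick J \<circ> inv_into UNIV q) j)"
    if "i < dim_row F" "j < dim_col F" for i j
  proof -
    have lt: "inv_into UNIV p i < dim_row F" "inv_into UNIV q j < dim_col F"
      using that permutes_in_image[OF permutes_inv[OF p], of i]
        permutes_in_image[OF permutes_inv[OF q], of j] by simp_all
    have "A $$ (pick I (inv_into UNIV p i), pick J (inv_into UNIV q j)) = submatrix A I J $$ (inv_into UNIV p i, inv_into UNIV q j)"
      by (rule submatrix_index[symmetric]) (simp_all add: sets card lt)
    then show ?thesis
      by (simp add: eq lt permutes_inverses[OF p] permutes_inverses[OF q])
  qed
  then show ?R
    using bij IJ
    by (intro exI[of _ "pick I \<circ> inv_into UNIV p"] exI[of _ "pick J \<circ> inv_into UNIV q"]) (simp add: bij_betw_def)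
next
  assume ?R
  then obtain f g where fg: "inj_on f {..<dim_row F} \<and> f ` {..<dim_row F} \<subseteq> {..<dim_row A} \<and>
        inj_on g {..<dim_col F} \<and> g ` {..<dim_col F} \<subseteq> {..<dim_col A} \<and>
        (\<forall>i<dim_row F. \<forall>j<dim_col F. F $$ (i, j) = A $$ (f i, g j))"
    by (elim exE)
  then have f: "inj_on f {..<dim_row F}" "f ` {..<dim_row F} \<subseteq> {..<dim_row A}"
    and g: "inj_on g {..<dim_col F}" "g ` {..<dim_col F} \<subseteq> {..<dim_col A}"
    and F: "\<And>i j. i < dim_row F \<Longrightarrow> j < dim_col F \<Longrightarrow> F $$ (i, j) = A $$ (f i, g j)"
    by simp_all
  define I J where "I = f ` {..<dim_row F}" and "J = g ` {..<dim_col F}"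
  obtain p where p: "p permutes {..<dim_row F}" "\<And>i. i < dim_row F \<Longrightarrow> f (p i) = pick I i"
    using exists_permutation_pick[OF f(1) I_def] by blast
  obtain q where q: "q permutes {..<dim_col F}" "\<And>j. j < dim_col F \<Longrightarrow> g (q j) = pick J j"
    using exists_permutation_pick[OF g(1) J_def] by blast
  have sets: "{i. i < dim_row A \<and> i \<in> I} = I" "{j. j < dim_col A \<and> j \<in> J} = J"
    using f g by (auto simp: I_def J_def)
  have card: "card I = dim_row F" "card J = dim_col F"
    using f g by (simp_all add: I_def J_def card_image)
  have "submatrix A I J = mat (dim_row F) (dim_col F) (\<lambda>(i, j). F $$ (p i, q j))"
  proof (rule eq_matI)
    fix i j
    assume "i < dim_row (mat (dim_row F) (dim_col F) (\<lambda>(i, j). F $$ (p i, q j)))"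
      and "j < dim_col (mat (dim_row F) (dim_col F) (\<lambda>(i, j). F $$ (p i, q j)))"
    then have ij: "i < dim_row F" "j < dim_col F"
      by simp_all
    have lt: "p i < dim_row F" "q j < dim_col F"
      using ij permutes_in_image[OF p(1), of i] permutes_in_image[OF q(1), of j] by simp_all
    have "submatrix A I J $$ (i, j) = A $$ (pick I i, pick J j)"
      by (rule submatrix_index) (simp_all add: sets card ij)
    then show "submatrix A I J $$ (i, j) = mat (dim_row F) (dim_col F) (\<lambda>(i, j). F $$ (p i, q j)) $$ (i, j)"
      by (simp add: ij F lt p q)
  qed (simp_all add: dim_submatrix sets card)
  then show "F \<prec> A"
    unfolding config_def perm_equiv_mat_def using p(1) q(1) f(2) g(2) I_def J_def by blast
qed

lemma configE:
  assumes "F \<prec> A"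
  obtains f g where "inj_on f {..<dim_row F}" "f ` {..<dim_row F} \<subseteq> {..<dim_row A}"
    "inj_on g {..<dim_col F}" "g ` {..<dim_col F} \<subseteq> {..<dim_col A}"
    "\<And>i j. i < dim_row F \<Longrightarrow> j < dim_col F \<Longrightarrow> F $$ (i, j) = A $$ (f i, g j)"
proof -
  obtain f g where fg: "inj_on f {..<dim_row F} \<and> f ` {..<dim_row F} \<subseteq> {..<dim_row A} \<and>
        inj_on g {..<dim_col F} \<and> g ` {..<dim_col F} \<subseteq> {..<dim_col A} \<and>
        (\<forall>i<dim_row F. \<forall>j<dim_col F. F $$ (i, j) = A $$ (f i, g j))"
    using assms unfolding config_iff by (elim exE)
  show thesis
    by (rule that[of f g]) (use fg in simp_all)
qed

section \<open>Column supports, incidence matrices and traces\<close>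

definition col_supp :: "nat mat \<Rightarrow> nat \<Rightarrow> nat set" where
  "col_supp A j = {i. i < dim_row A \<and> A $$ (i, j) = 1}"

text \<open>The bijections leave the order of rows and columns open, so \<open>F11\<close> and the
  products of identity matrices fit the same description.\<close>

definition incidence_mat :: "nat mat \<Rightarrow> 'a hypergraph \<Rightarrow> bool" where
  "incidence_mat F H \<longleftrightarrow>
     (\<exists>r c. bij_betw r {..<dim_row F} (fst H) \<and> bij_betw c {..<dim_col F} (snd H) \<and>
        (\<forall>i<dim_row F. \<forall>j<dim_col F. F $$ (i, j) = of_bool (r i \<in> c j)))"

lemma simple_mat_entry:
  assumes "simple_mat A" "i < dim_row A" "j < dim_col A"
  shows "A $$ (i, j) = of_bool (i \<in> col_supp A j)"
proof -
  have "A $$ (i, j) \<in> elements_mat A"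
    using assms by auto
  then show ?thesis
    using assms by (auto simp: simple_mat_def col_supp_def)
qed

lemma simple_mat_inj_col_supp:
  assumes "simple_mat A"
  shows "inj_on (col_supp A) {..<dim_col A}"
proof (rule inj_onI)
  fix j j' assume j: "j \<in> {..<dim_col A}" "j' \<in> {..<dim_col A}" "col_supp A j = col_supp A j'"
  then have "col A j = col A j'"
    by (intro eq_vecI) (simp_all add: simple_mat_entry[OF assms])
  then show "j = j'"
    using assms j by (auto simp: simple_mat_def distinct_conv_nth)
qed

text \<open>The sets in \<open>\<A>\<close> that induce the copies of the edges are automatically distinct, so the
  injectivity of the column embedding in a configuration need not be recorded.\<close>

definition trace_embeds :: "'a hypergraph \<Rightarrow> nat set \<Rightarrow> nat set set \<Rightarrow> bool" where
  "trace_embeds H W \<A> \<longleftrightarrow>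
     (\<exists>f. inj_on f (fst H) \<and> f ` fst H \<subseteq> W \<and> (\<forall>e\<in>snd H. \<exists>S\<in>\<A>. S \<inter> f ` fst H = f ` e))"

text \<open>The row injection and the vertex injection correspond through the labelling
  \<open>r\<close> of rows by vertices. On the chosen rows, a column of \<open>A\<close> equals the
  column of an edge exactly when the image of that edge is the trace of its support.\<close>

lemma config_iff_trace_embeds:
  assumes A: "simple_mat A" and H: "hypergraph H" and F: "incidence_mat F H"
  shows "F \<prec> A \<longleftrightarrow> trace_embeds H {..<dim_row A} (col_supp A ` {..<dim_col A})"
proof -
  obtain r c where r: "bij_betw r {..<dim_row F} (fst H)" and c: "bij_betw c {..<dim_col F} (snd H)"
    and F: "\<And>i j. i < dim_row F \<Longrightarrow> j < dim_col F \<Longrightarrow> F $$ (i, j) = of_bool (r i \<in> c j)"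
    using F unfolding incidence_mat_def by blast
  have r_im: "r ` {..<dim_row F} = fst H" and c_im: "c ` {..<dim_col F} = snd H"
    using r c by (simp_all add: bij_betw_def)
  show ?thesis
  proof
    assume "F \<prec> A"
    then obtain f g where f: "inj_on f {..<dim_row F}" "f ` {..<dim_row F} \<subseteq> {..<dim_row A}"
      and g: "inj_on g {..<dim_col F}" "g ` {..<dim_col F} \<subseteq> {..<dim_col A}"
      and FA: "\<And>i j. i < dim_row F \<Longrightarrow> j < dim_col F \<Longrightarrow> F $$ (i, j) = A $$ (f i, g j)"
      by (rule configE) blast
    define h where "h = f \<circ> inv_into {..<dim_row F} r"
    have hr: "h (r i) = f i" if "i < dim_row F" for i
      using that bij_betw_inv_into_left[OF r] by (simp add: h_def)
    have im: "h ` fst H = f ` {..<dim_row F}"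
      unfolding r_im[symmetric] image_image by (rule image_cong) (simp_all add: hr)
    have inj: "inj_on h (fst H)"
      unfolding h_def
      by (rule comp_inj_on) (use f bij_betw_inv_into[OF r] in \<open>auto simp: bij_betw_def\<close>)
    have "\<exists>S\<in>col_supp A ` {..<dim_col A}. S \<inter> h ` fst H = h ` e" if "e \<in> snd H" for e
    proof -
      obtain j where j: "j < dim_col F" "e = c j"
        using \<open>e \<in> snd H\<close> c_im by auto
      have gj: "g j < dim_col A"
        using g j by auto
      have e: "e \<subseteq> r ` {..<dim_row F}"
        using H \<open>e \<in> snd H\<close> by (simp add: hypergraph_def r_im)
      have iff: "f i \<in> col_supp A (g j) \<longleftrightarrow> r i \<in> e" if "i < dim_row F" for i
      proof -
        have "f i < dim_row A"
          using that f by auto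
        then have "of_bool (f i \<in> col_supp A (g j)) = (of_bool (r i \<in> e) :: nat)"
          using F[OF that j(1)] FA[OF that j(1)] simple_mat_entry[OF A _ gj] j(2) by simp
        then show ?thesis
          by (simp add: of_bool_eq_iff)
      qed
      have "col_supp A (g j) \<inter> h ` fst H = h ` e"
        unfolding im
      proof (intro equalityI subsetI)
        fix x assume "x \<in> col_supp A (g j) \<inter> f ` {..<dim_row F}"
        then obtain i where "i < dim_row F" "x = f i" "f i \<in> col_supp A (g j)"
          by auto
        then show "x \<in> h ` e"
          using iff hr by (metis imageI)
      next
        fix x assume "x \<in> h ` e"
        then obtain i where "i < dim_row F" "x = h (r i)" "r i \<in> e"
          using e by blast
        then show "x \<in> col_supp A (g j) \<inter> f ` {..<dim_row F}"
          using iff hr by auto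
      qed
      then show ?thesis
        using gj by blast
    qed
    then show "trace_embeds H {..<dim_row A} (col_supp A ` {..<dim_col A})"
      unfolding trace_embeds_def using inj im f(2) by (intro exI[of _ h]) auto
  next
    assume "trace_embeds H {..<dim_row A} (col_supp A ` {..<dim_col A})"
    then obtain h where h: "inj_on h (fst H)" "h ` fst H \<subseteq> {..<dim_row A}"
      and ex: "\<forall>e\<in>snd H. \<exists>S\<in>col_supp A ` {..<dim_col A}. S \<inter> h ` fst H = h ` e"
      unfolding trace_embeds_def by (elim exE conjE)
    have "\<exists>l<dim_col A. col_supp A l \<inter> h ` fst H = h ` c j" if "j \<in> {..<dim_col F}" for j
    proof -
      have "c j \<in> snd H"
        using that c_im by blast
      then show ?thesis
        using ex by auto
    qed
    then obtain g where g: "\<And>j. j < dim_col F \<Longrightarrow> g j < dim_col A"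
      "\<And>j. j < dim_col F \<Longrightarrow> col_supp A (g j) \<inter> h ` fst H = h ` c j"
      by (metis lessThan_iff)
    have c_sub: "c j \<subseteq> fst H" if "j < dim_col F" for j
      using that H c_im unfolding hypergraph_def by blast
    \<comment> \<open>The injective \<open>h\<close> maps different edges to different traces, and
      one column has only one trace.\<close>
    have "inj_on g {..<dim_col F}"
    proof (rule inj_onI)
      fix j j' assume j: "j \<in> {..<dim_col F}" "j' \<in> {..<dim_col F}" "g j = g j'"
      then have "h ` c j = h ` c j'"
        using g(2) by (metis lessThan_iff)
      then have "c j = c j'"
        using j c_sub h(1) by (simp add: inj_on_image_eq_iff)
      then show "j = j'"
        using j c by (auto simp: bij_betw_def inj_on_def)
    qed
    moreover have "inj_on (h \<circ> r) {..<dim_row F}"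
      using comp_inj_on[of r "{..<dim_row F}" h] r h r_im by (simp add: bij_betw_def)
    moreover have "(h \<circ> r) ` {..<dim_row F} \<subseteq> {..<dim_row A}"
      using h(2) unfolding image_comp[symmetric] r_im .
    moreover have "F $$ (i, j) = A $$ ((h \<circ> r) i, g j)" if "i < dim_row F" "j < dim_col F" for i j
    proof -
      have ri: "r i \<in> fst H"
        using that r_im by blast
      then have "h (r i) < dim_row A"
        using h by auto
      moreover have "h (r i) \<in> col_supp A (g j) \<longleftrightarrow> r i \<in> c j"
        using g(2)[OF that(2)] ri inj_on_image_mem_iff[OF h(1) ri c_sub[OF that(2)]] by blast
      ultimately show ?thesis
        using F[OF that] simple_mat_entry[OF A] g(1)[OF that(2)] by simp
    qed
    ultimately show "F \<prec> A"
      unfolding config_iff using g(1) by (intro exI[of _ "h \<circ> r"] exI[of _ g]) auto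
  qed
qed

text \<open>Distinct columns have distinct supports by simplicity, and the rows of an all-ones block
  are common elements of the two supports.\<close>

lemma ones_mat_config_iff:
  assumes A: "simple_mat A"
  shows "ones_mat k 2 \<prec> A \<longleftrightarrow>
    (\<exists>S\<in>col_supp A ` {..<dim_col A}. \<exists>T\<in>col_supp A ` {..<dim_col A}. S \<noteq> T \<and> k \<le> card (S \<inter> T))"
proof
  assume "ones_mat k 2 \<prec> A"
  then obtain f g where f: "inj_on f {..<k}" "f ` {..<k} \<subseteq> {..<dim_row A}"
      and g: "inj_on g {..<2::nat}" "g ` {..<2} \<subseteq> {..<dim_col A}"
      and FA: "\<And>i j. i < k \<Longrightarrow> j < 2 \<Longrightarrow> A $$ (f i, g j) = 1"
    by (rule configE) (simp add: ones_mat_def)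
  have g01: "g 0 < dim_col A" "g 1 < dim_col A" "g 0 \<noteq> g 1"
    using g(2) inj_onD[OF g(1), of 0 1] by (auto simp: image_subset_iff)
  then have "col_supp A (g 0) \<noteq> col_supp A (g 1)"
    using simple_mat_inj_col_supp[OF A] by (auto simp: inj_on_def)
  moreover have "f ` {..<k} \<subseteq> col_supp A (g 0) \<inter> col_supp A (g 1)"
    using f FA by (auto simp: col_supp_def)
  then have "card (f ` {..<k}) \<le> card (col_supp A (g 0) \<inter> col_supp A (g 1))"
    by (rule card_mono[rotated]) (simp add: col_supp_def)
  ultimately show "\<exists>S\<in>col_supp A ` {..<dim_col A}. \<exists>T\<in>col_supp A ` {..<dim_col A}. S \<noteq> T \<and> k \<le> card (S \<inter> T)"
    using g01 f(1) by (auto simp: card_image)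
next
  assume "\<exists>S\<in>col_supp A ` {..<dim_col A}. \<exists>T\<in>col_supp A ` {..<dim_col A}. S \<noteq> T \<and> k \<le> card (S \<inter> T)"
  then obtain a b where ab: "a < dim_col A" "b < dim_col A" "a \<noteq> b"
    "k \<le> card (col_supp A a \<inter> col_supp A b)"
    by auto
  obtain f where f: "inj_on f {..<k}" "f ` {..<k} \<subseteq> col_supp A a \<inter> col_supp A b"
    using ab(4) card_le_inj[of "{..<k}" "col_supp A a \<inter> col_supp A b"]
    by (auto simp: col_supp_def)
  define g where "g j = (if j = 0 then a else b)" for j :: nat
  show "ones_mat k 2 \<prec> A"
    unfolding config_iff
    using f ab by (intro exI[of _ f] exI[of _ g]) (auto simp: ones_mat_def g_def inj_on_def col_supp_def)
qed

text \<open>Supplies the converse of taking column supports, so that maxima over matrices become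
  maxima over set systems.\<close>

lemma exists_simple_mat:
  assumes "\<A> \<subseteq> Pow {..<m}"
  obtains A where "simple_mat A" "dim_row A = m" "dim_col A = card \<A>"
    "col_supp A ` {..<dim_col A} = \<A>"
proof -
  have "finite \<A>"
    using assms by (rule finite_subset) simp
  then obtain c where c: "bij_betw c {..<card \<A>} \<A>"
    using ex_bij_betw_nat_finite by (metis atLeast0LessThan)
  define A :: "nat mat" where "A = mat m (card \<A>) (\<lambda>(i, j). of_bool (i \<in> c j))"
  have dim: "dim_row A = m" "dim_col A = card \<A>"
    by (simp_all add: A_def)
  have supp: "col_supp A j = c j" if "j < card \<A>" for j
  proof -
    have "c j \<subseteq> {..<m}"
      using that bij_betwE[OF c] assms by blast
    then show ?thesis
      using that by (auto simp: col_supp_def A_def subset_iff of_bool_def split: if_splits)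
  qed
  have "cols A ! i \<noteq> cols A ! j" if "i < card \<A>" "j < card \<A>" "i \<noteq> j" for i j
  proof
    assume "cols A ! i = cols A ! j"
    then have "col A i = col A j"
      using that by (simp add: dim)
    then have "A $$ (l, i) = A $$ (l, j)" if "l < m" for l
      using that \<open>i < _\<close> \<open>j < _\<close> by (metis dim index_col)
    then have "col_supp A i = col_supp A j"
      by (auto simp: col_supp_def dim)
    then show False
      using that supp c by (auto simp: bij_betw_def inj_on_def)
  qed
  then have "simple_mat A"
    unfolding simple_mat_def by (auto simp: distinct_conv_nth dim) (auto simp: A_def)
  moreover have "col_supp A ` {..<dim_col A} = \<A>"
    using c supp by (simp add: dim bij_betw_def)
  ultimately show thesis
    using that dim by blast
qed

section \<open>Incidence matrices of complete multipartite hypergraphs\<close>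

lemma complete_partite_simps:
  "fst (complete_partite s) = (SIGMA i:{..<length s}. {..<s ! i})"
  "e \<in> snd (complete_partite s) \<longleftrightarrow>
     e \<subseteq> (SIGMA i:{..<length s}. {..<s ! i}) \<and> (\<forall>i<length s. \<exists>!v. v \<in> e \<and> fst v = i)"
  by (simp_all add: complete_partite_def Let_def)

lemma hypergraph_complete_partite: "hypergraph (complete_partite s)"
  by (simp add: hypergraph_def complete_partite_simps)

text \<open>On an edge, \<open>fst\<close> is a bijection onto the part indices.\<close>

lemma uniform_complete_partite: "uniform (length s) (complete_partite s)"
  unfolding uniform_def
proof (intro ballI)
  fix e assume "e \<in> snd (complete_partite s)"
  then have sub: "e \<subseteq> (SIGMA i:{..<length s}. {..<s ! i})"
    and un: "\<And>i. i < length s \<Longrightarrow> \<exists>!v. v \<in> e \<and> fst v = i"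
    by (simp_all add: complete_partite_simps)
  have "fst ` e = {..<length s}"
  proof
    show "{..<length s} \<subseteq> fst ` e"
      using un by (metis imageI lessThan_iff subsetI)
  qed (use sub in auto)
  moreover have "inj_on fst e"
    using un sub unfolding inj_on_def by (metis SigmaD1 lessThan_iff prod.collapse subsetD)
  ultimately have "bij_betw fst e {..<length s}"
    by (simp add: bij_betw_def)
  then show "finite e \<and> card e = length s"
    using bij_betw_finite bij_betw_same_card by fastforce
qed

text \<open>Nonempty parts all contain vertex 0, and these vertices form a transversal.\<close>

lemma complete_partite_has_edge:
  assumes "\<forall>i<length s. s ! i > 0"
  shows "snd (complete_partite s) \<noteq> {}"
proof -
  have "(\<lambda>i. (i, 0)) ` {..<length s} \<in> snd (complete_partite s)"
    using assms by (auto simp: complete_partite_simps)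
  then show ?thesis
    by blast
qed

text \<open>Replace the vertex of \<open>e\<close> in the part of \<open>v\<close> by
  \<open>v\<close>; the new edge differs because it contains \<open>v\<close>.\<close>

lemma complete_partite_exchange:
  assumes e: "e \<in> snd (complete_partite s)" and v: "v \<in> fst (complete_partite s)" "v \<notin> e"
  shows "\<exists>e'\<in>snd (complete_partite s). e' \<noteq> e \<and> e' \<subseteq> insert v e"
proof -
  define e' where "e' = insert v {w \<in> e. fst w \<noteq> fst v}"
  have "\<exists>!w. w \<in> e' \<and> fst w = i" if "i < length s" for i
  proof (cases "i = fst v")
    case True
    then show ?thesis
      by (auto simp: e'_def)
  next
    case False
    then have "w \<in> e' \<and> fst w = i \<longleftrightarrow> w \<in> e \<and> fst w = i" for w
      by (auto simp: e'_def)
    then show ?thesis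
      using e that by (simp add: complete_partite_simps)
  qed
  moreover have "e' \<subseteq> (SIGMA i:{..<length s}. {..<s ! i})"
    using e v(1) unfolding complete_partite_simps e'_def by blast
  ultimately have "e' \<in> snd (complete_partite s)"
    by (simp add: complete_partite_simps)
  then show ?thesis
    by (rule rev_bexI) (use v(2) in \<open>auto simp: e'_def\<close>)
qed

lemma complete_partite_Cons_vertices:
  "fst (complete_partite (n # s)) = Pair 0 ` {..<n} \<union> map_prod Suc id ` fst (complete_partite s)"
proof (intro equalityI subsetI)
  fix v assume v: "v \<in> fst (complete_partite (n # s))"
  show "v \<in> Pair 0 ` {..<n} \<union> map_prod Suc id ` fst (complete_partite s)"
  proof (cases "fst v")
    case 0
    then show ?thesis
      using v by (cases v) (simp add: complete_partite_simps)
  next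
    case (Suc i)
    then have "v = map_prod Suc id (i, snd v)" "(i, snd v) \<in> fst (complete_partite s)"
      using v by (cases v; simp add: complete_partite_simps)+
    then show ?thesis
      by blast
  qed
next
  fix v assume "v \<in> Pair 0 ` {..<n} \<union> map_prod Suc id ` fst (complete_partite s)"
  then show "v \<in> fst (complete_partite (n # s))"
    unfolding complete_partite_simps by (elim UnE imageE SigmaE) simp_all
qed

text \<open>Removing the vertex in part 0 and lowering the other part indices by one inverts the map
  on the right. This is the recursion by which \<open>prod_mats\<close> puts one more matrix on
  top.\<close>

lemma complete_partite_Cons_edges:
  "snd (complete_partite (n # s)) =
     (\<lambda>(a, e). insert (0, a) (map_prod Suc id ` e)) ` ({..<n} \<times> snd (complete_partite s))"
proof (intro equalityI subsetI)
  fix e assume e: "e \<in> snd (complete_partite (n # s))"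
  then have sub: "e \<subseteq> fst (complete_partite (n # s))"
    and un: "\<And>i. i < Suc (length s) \<Longrightarrow> \<exists>!v. v \<in> e \<and> fst v = i"
    by (simp_all add: complete_partite_simps)
  define e0 where "e0 = map_prod Suc id -` e"
  obtain a where a: "(0, a) \<in> e" "\<And>b. (0, b) \<in> e \<Longrightarrow> b = a"
    using un[of 0] by (metis fst_conv prod.collapse zero_less_Suc prod.inject)
  have e_eq: "e = insert (0, a) (map_prod Suc id ` e0)"
  proof (intro equalityI subsetI)
    fix v assume v: "v \<in> e"
    show "v \<in> insert (0, a) (map_prod Suc id ` e0)"
    proof (cases "fst v")
      case 0
      then show ?thesis
        using v a by (cases v) auto
    next
      case (Suc i)
      then have "v = map_prod Suc id (i, snd v)" "(i, snd v) \<in> e0"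
        using v by (cases v; simp add: e0_def)+
      then show ?thesis
        by blast
    qed
  qed (use a(1) in \<open>auto simp: e0_def\<close>)
  have "e0 \<in> snd (complete_partite s)"
    unfolding complete_partite_simps
  proof (intro conjI allI impI)
    show "e0 \<subseteq> (SIGMA i:{..<length s}. {..<s ! i})"
      using sub by (auto simp: e0_def complete_partite_simps)
    fix i assume "i < length s"
    then obtain w where w: "w \<in> e" "fst w = Suc i" "\<And>v. v \<in> e \<Longrightarrow> fst v = Suc i \<Longrightarrow> v = w"
      using un[of "Suc i"] by auto
    show "\<exists>!v. v \<in> e0 \<and> fst v = i"
    proof (rule ex1I[of _ "(i, snd w)"])
      show "(i, snd w) \<in> e0 \<and> fst (i, snd w) = i"
        using w(1,2) by (cases w) (simp add: e0_def)
      show "v = (i, snd w)" if "v \<in> e0 \<and> fst v = i" for v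
        using that w(3)[of "map_prod Suc id v"] by (cases v) (auto simp: e0_def)
    qed
  qed
  moreover have "a < n"
    using a(1) sub by (auto simp: complete_partite_simps)
  ultimately show "e \<in> (\<lambda>(a, e). insert (0, a) (map_prod Suc id ` e)) ` ({..<n} \<times> snd (complete_partite s))"
    using e_eq by auto
next
  fix e assume "e \<in> (\<lambda>(a, e). insert (0, a) (map_prod Suc id ` e)) ` ({..<n} \<times> snd (complete_partite s))"
  then obtain a e0 where a: "a < n" and e0: "e0 \<in> snd (complete_partite s)"
    and e: "e = insert (0, a) (map_prod Suc id ` e0)"
    by auto
  have sub: "e \<subseteq> fst (complete_partite (n # s))"
    using a e0 unfolding complete_partite_Cons_vertices e by (auto simp: complete_partite_simps)
  have "\<exists>!v. v \<in> e \<and> fst v = i" if "i < length (n # s)" for i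
  proof (cases i)
    case 0
    then show ?thesis
      by (intro ex1I[of _ "(0, a)"]) (auto simp: e)
  next
    case (Suc j)
    then have "\<exists>!v. v \<in> e0 \<and> fst v = j"
      using that e0 by (simp add: complete_partite_simps)
    then obtain w where w: "w \<in> e0" "fst w = j" "\<And>v. v \<in> e0 \<Longrightarrow> fst v = j \<Longrightarrow> v = w"
      by blast
    show ?thesis
    proof (rule ex1I[of _ "map_prod Suc id w"])
      show "map_prod Suc id w \<in> e \<and> fst (map_prod Suc id w) = i"
        using w(1,2) Suc by (simp add: e)
      show "v = map_prod Suc id w" if "v \<in> e \<and> fst v = i" for v
      proof -
        have "v \<in> map_prod Suc id ` e0"
          using that Suc unfolding e by (metis fst_conv insertE nat.distinct(1))
        then obtain u where u: "v = map_prod Suc id u" "u \<in> e0"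
          by (rule imageE)
        then have "fst u = j"
          using that Suc by simp
        with u(2) have "u = w"
          by (rule w(3))
        then show ?thesis
          using u(1) by (rule subst)
      qed
    qed
  qed
  then show "e \<in> snd (complete_partite (n # s))"
    using sub by (simp add: complete_partite_simps)
qed

text \<open>The column numbering of \<open>prod_mat\<close>: quotient and remainder name the columns
  of the upper and the lower factor.\<close>

lemma bij_betw_div_mod:
  "bij_betw (\<lambda>j. (j div d, j mod d)) {..<n * d} ({..<n} \<times> {..<d::nat})"
proof (rule bij_betw_byWitness[where f' = "\<lambda>(a, b). a * d + b"])
  \<comment> \<open>A remainder is below \<open>d\<close> only for positive \<open>d\<close>; for
    \<open>d = 0\<close> the range \<open>{..<n * d}\<close> is empty.\<close>
  show "(\<lambda>j. (j div d, j mod d)) ` {..<n * d} \<subseteq> {..<n} \<times> {..<d}"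
    by (auto simp: less_mult_imp_div_less) (metis mod_less_divisor mult_0_right neq0_conv not_less0)
  have "a * d + b < n * d" if "a < n" "b < d" for a b
  proof -
    have "a * d + b < Suc a * d"
      using that by simp
    also have "\<dots> \<le> n * d"
      using that by (intro mult_right_mono) auto
    finally show ?thesis .
  qed
  then show "(\<lambda>(a, b). a * d + b) ` ({..<n} \<times> {..<d}) \<subseteq> {..<n * d}"
    by auto
  show "\<forall>j\<in>{..<n * d}. (\<lambda>(a, b). a * d + b) (j div d, j mod d) = j"
    by simp
  show "\<forall>p\<in>{..<n} \<times> {..<d}. (\<lambda>j. (j div d, j mod d)) ((\<lambda>(a, b). a * d + b) p) = p"
    by clarsimp
qed

text \<open>Column \<open>a\<close> of the identity matrix picks the vertex \<open>(0, a)\<close> of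
  the new part, and the block below adds an edge on the remaining parts.\<close>

lemma incidence_prod_mat_one:
  assumes "incidence_mat P (complete_partite s)"
  shows "incidence_mat (prod_mat (1\<^sub>m n) P) (complete_partite (n # s))"
proof -
  obtain r c where r: "bij_betw r {..<dim_row P} (fst (complete_partite s))"
    and c: "bij_betw c {..<dim_col P} (snd (complete_partite s))"
    and P: "\<And>i j. i < dim_row P \<Longrightarrow> j < dim_col P \<Longrightarrow> P $$ (i, j) = of_bool (r i \<in> c j)"
    using assms unfolding incidence_mat_def by blast
  let ?sh = "map_prod Suc id :: nat \<times> nat \<Rightarrow> nat \<times> nat"
  have inj_sh: "inj ?sh"
    by (auto intro!: injI)
  \<comment> \<open>Rows below \<open>n\<close> become the new part; the other rows keep their old
    vertices, shifted by one part.\<close>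
  define r' where "r' i = (if i < n then (0, i) else ?sh (r (i - n)))" for i
  define c' where "c' j = insert (0, j div dim_col P) (?sh ` c (j mod dim_col P))" for j
  have "bij_betw r' ({..<n} \<union> {n..<n + dim_row P}) (fst (complete_partite (n # s)))"
    unfolding complete_partite_Cons_vertices
  proof (rule bij_betw_combine)
    show "bij_betw r' {..<n} (Pair 0 ` {..<n})"
      by (auto simp: bij_betw_def inj_on_def r'_def)
    have "bij_betw (\<lambda>i. i - n) {n..<n + dim_row P} {..<dim_row P}"
      by (rule bij_betw_byWitness[where f' = "\<lambda>i. i + n"]) auto
    moreover have "bij_betw ?sh (fst (complete_partite s)) (?sh ` fst (complete_partite s))"
      by (rule inj_on_imp_bij_betw) (use inj_sh in \<open>auto simp: inj_on_def\<close>)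
    ultimately have "bij_betw (?sh \<circ> (r \<circ> (\<lambda>i. i - n))) {n..<n + dim_row P} (?sh ` fst (complete_partite s))"
      using r by (intro bij_betw_trans[of _ _ "fst (complete_partite s)"] bij_betw_trans[of _ _ "{..<dim_row P}"])
    then show "bij_betw r' {n..<n + dim_row P} (?sh ` fst (complete_partite s))"
      by (rule bij_betw_cong[THEN iffD1, rotated]) (simp add: r'_def)
  qed auto
  moreover have "{..<n} \<union> {n..<n + dim_row P} = {..<n + dim_row P}"
    by auto
  ultimately have "bij_betw r' {..<n + dim_row P} (fst (complete_partite (n # s)))"
    by simp
  moreover have "bij_betw c' {..<n * dim_col P} (snd (complete_partite (n # s)))"
  proof -
    let ?g = "\<lambda>(a, e). insert (0, a) (?sh ` e)"
    have "bij_betw ?g ({..<n} \<times> snd (complete_partite s)) (snd (complete_partite (n # s)))"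
      unfolding complete_partite_Cons_edges
    proof (rule inj_on_imp_bij_betw, rule inj_onI, clarify)
      fix a a' e e' assume eq: "insert (0, a) (?sh ` e) = insert (0, a') (?sh ` e')"
      \<comment> \<open>A shifted vertex never lies in part 0, so both components of an edge can be
        read off.\<close>
      have notin: "(0, x) \<notin> ?sh ` e" for x e
        by auto
      then have "a = a'"
        using eq by (metis Pair_inject insertE insertI1)
      moreover have "?sh ` e = ?sh ` e'"
        using eq notin \<open>a = a'\<close> by (simp add: insert_ident)
      then have "e = e'"
        using inj_sh by (simp add: inj_image_eq_iff)
      ultimately show "a = a' \<and> e = e'" ..
    qed
    moreover have "bij_betw (map_prod id c) ({..<n} \<times> {..<dim_col P}) ({..<n} \<times> snd (complete_partite s))"
      using c by (intro bij_betw_map_prod) auto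
    ultimately have "bij_betw (?g \<circ> (map_prod id c \<circ> (\<lambda>j. (j div dim_col P, j mod dim_col P))))
        {..<n * dim_col P} (snd (complete_partite (n # s)))"
      by (intro bij_betw_trans[of _ _ "{..<n} \<times> snd (complete_partite s)"]
          bij_betw_trans[OF bij_betw_div_mod])
    then show ?thesis
      by (rule bij_betw_cong[THEN iffD1, rotated]) (simp add: c'_def)
  qed
  moreover have "prod_mat (1\<^sub>m n) P $$ (i, j) = of_bool (r' i \<in> c' j)"
    if ij: "i < n + dim_row P" "j < n * dim_col P" for i j
  proof -
    have j: "j div dim_col P < n" "j mod dim_col P < dim_col P"
      using ij bij_betwE[OF bij_betw_div_mod[of "dim_col P" n]] by auto
    show ?thesis
    proof (cases "i < n")
      case True
      then show ?thesis
        using ij j by (auto simp: prod_mat_def r'_def c'_def)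
    next
      case False
      then have "r' i \<in> c' j \<longleftrightarrow> r (i - n) \<in> c (j mod dim_col P)"
        by (auto simp: r'_def c'_def inj_image_mem_iff[OF inj_sh] simp del: map_prod_def)
           (simp add: map_prod_def split: prod.splits)
      then show ?thesis
        using False ij j P[of "i - n" "j mod dim_col P"] by (simp add: prod_mat_def)
    qed
  qed
  ultimately show ?thesis
    unfolding incidence_mat_def
    by (intro exI[of _ r'] exI[of _ c']) (simp add: prod_mat_def)
qed

lemma incidence_prod_mats:
  "incidence_mat (prod_mats (map (\<lambda>n. 1\<^sub>m n) s)) (complete_partite s)"
proof (induction s)
  case Nil
  \<comment> \<open>Without parts there is exactly one edge, the empty set, matching the neutral
    matrix with no rows and one column.\<close>
  have "fst (complete_partite []) = {}" "snd (complete_partite []) = {{}}"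
    by (auto simp: complete_partite_def)
  then show ?case
    unfolding incidence_mat_def
    by (intro exI[of _ undefined] exI[of _ "\<lambda>_. {}"]) (auto simp: prod_mats_def bij_betw_def lessThan_Suc)
next
  case (Cons n s)
  then show ?case
    using incidence_prod_mat_one by (simp add: prod_mats_def)
qed

section \<open>The bipartite graph with two parts of size two\<close>

lemma less_4_cases: "(i::nat) < 4 \<longleftrightarrow> i = 0 \<or> i = 1 \<or> i = 2 \<or> i = 3"
  by auto

lemma lessThan_2: "{..<2::nat} = {0, 1}"
  by auto

lemma K22_simps:
  "fst (complete_bipartite 2 2) = {Inl 0, Inl 1, Inr 0, Inr 1}"
  "snd (complete_bipartite 2 2) = {{Inl 0, Inr 0}, {Inl 0, Inr 1}, {Inl 1, Inr 0}, {Inl 1, Inr 1}}"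
proof -
  show "fst (complete_bipartite 2 2) = {Inl 0, Inl 1, Inr 0, Inr 1}"
    by (auto simp: complete_bipartite_def lessThan_2)
  have "snd (complete_bipartite 2 2) = (\<lambda>(i, j). {Inl i, Inr j}) ` ({..<2} \<times> {..<2})"
    by (auto simp: complete_bipartite_def)
  then show "snd (complete_bipartite 2 2) = {{Inl 0, Inr 0}, {Inl 0, Inr 1}, {Inl 1, Inr 0}, {Inl 1, Inr 1}}"
    by (auto simp: lessThan_2)
qed

lemma incidence_F11: "incidence_mat F11 (complete_bipartite 2 2)"
proof -
  \<comment> \<open>The columns of \<open>F11\<close> are the edges of a 4-cycle through rows 0, 1,
    3, 2, with colour classes {0, 3} and {1, 2}.\<close>
  define r :: "nat \<Rightarrow> nat + nat"
    where "r = (\<lambda>_. undefined)(0 := Inl 0, 1 := Inr 0, 2 := Inr 1, 3 := Inl 1)"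
  define c :: "nat \<Rightarrow> (nat + nat) set"
    where "c = (\<lambda>_. undefined)(0 := {Inl 0, Inr 0}, 1 := {Inl 1, Inr 1}, 2 := {Inl 0, Inr 1}, 3 := {Inl 1, Inr 0})"
  have 4: "{..<4::nat} = {0, 1, 2, 3}"
    by auto
  have dim: "dim_row F11 = 4" "dim_col F11 = 4"
    by (simp_all add: F11_def mat_of_rows_list_def)
  have "bij_betw r {..<4} (fst (complete_bipartite 2 2))"
    unfolding K22_simps 4 by (auto simp: bij_betw_def r_def)
  moreover have "bij_betw c {..<4} (snd (complete_bipartite 2 2))"
    unfolding K22_simps 4 by (auto simp: bij_betw_def c_def doubleton_eq_iff)
  moreover have "F11 $$ (i, j) = of_bool (r i \<in> c j)" if "i < 4" "j < 4" for i j
    using that unfolding less_4_cases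
    by (elim disjE) (simp_all add: F11_def mat_of_rows_list_def r_def c_def)
  ultimately show ?thesis
    unfolding incidence_mat_def
    by (intro exI[of _ r] exI[of _ c]) (simp add: dim)
qed

lemma hypergraph_complete_bipartite: "hypergraph (complete_bipartite a b)"
  by (force simp: hypergraph_def complete_bipartite_def)

lemma uniform_complete_bipartite: "uniform 2 (complete_bipartite a b)"
  by (auto simp: uniform_def complete_bipartite_def)

text \<open>The vertex \<open>v\<close> replaces the endpoint of \<open>e\<close> on its own
  side.\<close>

lemma complete_bipartite_exchange:
  assumes e: "e \<in> snd (complete_bipartite a b)" and v: "v \<in> fst (complete_bipartite a b)" "v \<notin> e"
  shows "\<exists>e'\<in>snd (complete_bipartite a b). e' \<noteq> e \<and> e' \<subseteq> insert v e"
proof -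
  obtain i j where ij: "e = {Inl i, Inr j}" "i < a" "j < b"
    using e by (auto simp: complete_bipartite_def)
  have mem: "{Inl x, Inr y} \<in> snd (complete_bipartite a b)" if "x < a" "y < b" for x y
    using that by (auto simp: complete_bipartite_def)
  show ?thesis
  proof (cases v)
    case (Inl x)
    then show ?thesis
      using v ij by (intro bexI[OF _ mem[of x j]]) (auto simp: complete_bipartite_def)
  next
    case (Inr y)
    then show ?thesis
      using v ij by (intro bexI[OF _ mem[of i y]]) (auto simp: complete_bipartite_def)
  qed
qed

section \<open>Extremal numbers\<close>

text \<open>Copies need not be induced: the image may span further edges. This is the counterpart of
  \<open>trace_embeds\<close> on the side of \<open>ex\<close>.\<close>

definition embeds :: "'a hypergraph \<Rightarrow> 'b hypergraph \<Rightarrow> bool" where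
  "embeds H G \<longleftrightarrow> (\<exists>f. inj_on f (fst H) \<and> f ` fst H \<subseteq> fst G \<and> (\<forall>e\<in>snd H. f ` e \<in> snd G))"

text \<open>The image of an embedding is the required copy; \<open>hypergraph H\<close> keeps its
  edges inside its vertex set.\<close>

lemma embeds_iff_isomorphic_subhypergraph:
  assumes "hypergraph H"
  shows "embeds H G \<longleftrightarrow> (\<exists>G'. subhypergraph G' G \<and> isomorphic H G')"
proof
  assume "embeds H G"
  then obtain f where f: "inj_on f (fst H)" "f ` fst H \<subseteq> fst G" "\<And>e. e \<in> snd H \<Longrightarrow> f ` e \<in> snd G"
    unfolding embeds_def by blast
  let ?G' = "(f ` fst H, (\<lambda>e. f ` e) ` snd H)"
  have "subhypergraph ?G' G"
    using f assms unfolding subhypergraph_def hypergraph_def by (auto 0 3)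
  moreover have "isomorphic H ?G'"
    unfolding isomorphic_def using f(1) by (intro exI[of _ f]) (simp add: bij_betw_def)
  ultimately show "\<exists>G'. subhypergraph G' G \<and> isomorphic H G'"
    by blast
next
  assume "\<exists>G'. subhypergraph G' G \<and> isomorphic H G'"
  then obtain G' f where "subhypergraph G' G" "bij_betw f (fst H) (fst G')"
    "snd G' = (\<lambda>e. f ` e) ` snd H"
    unfolding isomorphic_def by blast
  then show "embeds H G"
    unfolding embeds_def subhypergraph_def by (intro exI[of _ f]) (auto simp: bij_betw_def)
qed

text \<open>The vertex set is always \<open>{..<m}\<close>, so the edge set alone represents a
  hypergraph.\<close>

definition free_edge_sets :: "nat \<Rightarrow> nat \<Rightarrow> 'b hypergraph \<Rightarrow> nat set set set" where
  "free_edge_sets k m H = {E. (\<forall>e\<in>E. e \<subseteq> {..<m} \<and> card e = k) \<and> \<not> embeds H ({..<m}, E)}"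

lemma ex_eq_Max_free:
  assumes "hypergraph H"
  shows "ex k m H = Max (card ` free_edge_sets k m H)"
proof -
  have "{card (snd G) |G. fst G = {..<m} \<and> hypergraph G \<and> uniform k G \<and>
      \<not> (\<exists>G'. subhypergraph G' G \<and> isomorphic H G')} = card ` free_edge_sets k m H"
    unfolding embeds_iff_isomorphic_subhypergraph[OF assms, symmetric] free_edge_sets_def
      hypergraph_def uniform_def
    by (force intro: finite_subset[of _ "{..<m}"])
  then show ?thesis
    by (simp add: ex_def)
qed

lemma finite_free_edge_sets: "finite (free_edge_sets k m H)"
  by (rule finite_subset[of _ "Pow (Pow {..<m})"]) (auto simp: free_edge_sets_def)

lemma ex_upper:
  assumes "hypergraph H" "E \<in> free_edge_sets k m H"
  shows "card E \<le> ex k m H"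
  using assms by (simp add: ex_eq_Max_free finite_free_edge_sets)

text \<open>An edge of \<open>H\<close> makes the empty edge set free, so the maximum is taken over
  a nonempty set.\<close>

lemma ex_attained:
  assumes "hypergraph H" "snd H \<noteq> {}"
  obtains E where "E \<in> free_edge_sets k m H" "card E = ex k m H"
proof -
  have "{} \<in> free_edge_sets k m H"
    using assms(2) by (auto simp: free_edge_sets_def embeds_def)
  then have "Max (card ` free_edge_sets k m H) \<in> card ` free_edge_sets k m H"
    by (intro Max_in) (auto simp: finite_free_edge_sets)
  then show thesis
    using that by (auto simp: ex_eq_Max_free[OF assms(1)])
qed

text \<open>Passing from a simple matrix to its column supports preserves the number of columns, and
  every set system arises this way. Both forbidden configurations have been expressed through
  supports.\<close>

lemma forb_eq_Max_set_systems:
  assumes "hypergraph H" "incidence_mat F H"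
  shows "forb m {ones_mat k 2, F} =
    Max (card ` {\<A>. \<A> \<subseteq> Pow {..<m} \<and> (\<forall>S\<in>\<A>. \<forall>T\<in>\<A>. S \<noteq> T \<longrightarrow> card (S \<inter> T) < k) \<and>
                     \<not> trace_embeds H {..<m} \<A>})" (is "_ = Max (card ` ?X)")
proof -
  have "{dim_col A |A. dim_row A = m \<and> simple_mat A \<and> (\<forall>F'\<in>{ones_mat k 2, F}. \<not> F' \<prec> A)} = card ` ?X"
    (is "?D = _")
  proof (intro equalityI subsetI)
    fix d assume "d \<in> ?D"
    then obtain A where A: "d = dim_col A" "dim_row A = m" "simple_mat A"
      and free: "\<not> ones_mat k 2 \<prec> A" "\<not> F \<prec> A"
      by auto
    let ?A = "col_supp A ` {..<dim_col A}"
    have "card ?A = d"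
      using simple_mat_inj_col_supp[OF A(3)] A(1) by (simp add: card_image)
    moreover have "?A \<in> ?X"
      using free unfolding ones_mat_config_iff[OF A(3)] config_iff_trace_embeds[OF A(3) assms] A(2)
      using A(2) by (auto simp: col_supp_def not_le)
    ultimately show "d \<in> card ` ?X"
      by blast
  next
    fix d assume "d \<in> card ` ?X"
    then obtain \<A> where W: "\<A> \<in> ?X" and d: "d = card \<A>"
      by blast
    then obtain A where A: "simple_mat A" "dim_row A = m" "dim_col A = card \<A>"
      "col_supp A ` {..<dim_col A} = \<A>"
      using exists_simple_mat[of \<A> m] by blast
    have "\<not> ones_mat k 2 \<prec> A" "\<not> F \<prec> A"
      unfolding ones_mat_config_iff[OF A(1)] config_iff_trace_embeds[OF A(1) assms] A(2,4)
      using W by (auto simp: not_le)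
    then show "d \<in> ?D"
      using A d by (intro CollectI exI[of _ A]) simp
  qed
  then show ?thesis
    by (simp add: forb_def)
qed

section \<open>The size of an extremal set system\<close>

lemma card_subsets_card_less:
  assumes "finite W"
  shows "card {S. S \<subseteq> W \<and> card S < k} = (\<Sum>i<k. card W choose i)"
proof -
  have "{S. S \<subseteq> W \<and> card S < k} = (\<Union>i<k. {S. S \<subseteq> W \<and> card S = i})"
    by auto
  also have "card \<dots> = (\<Sum>i<k. card {S. S \<subseteq> W \<and> card S = i})"
    by (rule card_UN_disjoint) (use assms in auto)
  finally show ?thesis
    using assms by (simp add: n_subsets)
qed

text \<open>The exchange property is what the upper bound needs: it prevents a set that contains the
  chosen copy of an edge from meeting the rest of the copy of \<open>H\<close>.\<close>

theorem forb_eq_binomials_plus_ex: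
  assumes H: "hypergraph H" "uniform k H" "snd H \<noteq> {}"
    and F: "incidence_mat F H"
    and exchange: "\<And>e v. e \<in> snd H \<Longrightarrow> v \<in> fst H \<Longrightarrow> v \<notin> e \<Longrightarrow> \<exists>e'\<in>snd H. e' \<noteq> e \<and> e' \<subseteq> insert v e"
  shows "forb m {ones_mat k 2, F} = (\<Sum>i<k. m choose i) + ex k m H"
  unfolding forb_eq_Max_set_systems[OF H(1) F]
proof (rule Max_eqI)
  let ?X = "{\<A>. \<A> \<subseteq> Pow {..<m} \<and> (\<forall>S\<in>\<A>. \<forall>T\<in>\<A>. S \<noteq> T \<longrightarrow> card (S \<inter> T) < k) \<and>
                     \<not> trace_embeds H {..<m} \<A>}"
  let ?small = "{S. S \<subseteq> {..<m} \<and> card S < k}"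
  have small: "card ?small = (\<Sum>i<k. m choose i)" "finite ?small"
    using card_subsets_card_less[of "{..<m}"] by simp_all
  show "finite (card ` ?X)"
    by (intro finite_imageI, rule finite_subset[of _ "Pow (Pow {..<m})"]) auto
  show "d \<le> (\<Sum>i<k. m choose i) + ex k m H" if d: "d \<in> card ` ?X" for d
  proof -
    obtain \<A> where W: "\<A> \<in> ?X" and d: "d = card \<A>"
      using d by blast
    then have sub: "\<A> \<subseteq> Pow {..<m}" and free: "\<not> trace_embeds H {..<m} \<A>"
      and less: "\<forall>S\<in>\<A>. \<forall>T\<in>\<A>. S \<noteq> T \<longrightarrow> card (S \<inter> T) < k"
      by simp_all
    have meet: "S = T" if "S \<in> \<A>" "T \<in> \<A>" "k \<le> card (S \<inter> T)" for S T
      using that less by (meson leD)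
    have fin: "finite S" if "S \<in> \<A>" for S
      using that sub by (meson PowD finite_lessThan finite_subset subsetD)
    \<comment> \<open>Sets below size \<open>k\<close> are counted by the binomial coefficients;
      only \<open>B\<close> is compared with \<open>ex\<close>.\<close>
    define B where "B = {S \<in> \<A>. k \<le> card S}"
    have "\<forall>S\<in>B. \<exists>T. T \<subseteq> S \<and> card T = k"
      unfolding B_def using obtain_subset_with_card_n by (metis (no_types, lifting) mem_Collect_eq)
    then obtain \<phi> where \<phi>: "\<And>S. S \<in> B \<Longrightarrow> \<phi> S \<subseteq> S" "\<And>S. S \<in> B \<Longrightarrow> card (\<phi> S) = k"
      by metis
    \<comment> \<open>\<open>\<phi> S\<close> has \<open>k\<close> elements and lies in both sets,
      so \<open>S\<close> and \<open>T\<close> share at least \<open>k\<close> elements.\<close>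
    have \<phi>_eq: "S = T" if "S \<in> B" "T \<in> B" "\<phi> S \<subseteq> T" for S T
    proof (rule meet)
      show "k \<le> card (S \<inter> T)"
        using that \<phi> fin card_mono[of "S \<inter> T" "\<phi> S"] by (auto simp: B_def)
    qed (use that in \<open>auto simp: B_def\<close>)
    have "\<phi> ` B \<in> free_edge_sets k m H"
    proof -
      have "\<not> embeds H ({..<m}, \<phi> ` B)"
      proof
        assume "embeds H ({..<m}, \<phi> ` B)"
        then obtain f where f: "inj_on f (fst H)" "f ` fst H \<subseteq> {..<m}"
          and edge: "\<And>e. e \<in> snd H \<Longrightarrow> f ` e \<in> \<phi> ` B"
          unfolding embeds_def by auto
        have "\<exists>S\<in>\<A>. S \<inter> f ` fst H = f ` e" if e: "e \<in> snd H" for e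
        proof -
          obtain S where S: "S \<in> B" "f ` e = \<phi> S"
            using edge[OF e] by blast
          have e_sub: "e' \<subseteq> fst H" if "e' \<in> snd H" for e'
            using that H(1) by (auto simp: hypergraph_def)
          have "v \<in> e" if v: "v \<in> fst H" "f v \<in> S" for v
          proof (rule ccontr)
            assume "v \<notin> e"
            then obtain e' where e': "e' \<in> snd H" "e' \<noteq> e" "e' \<subseteq> insert v e"
              using exchange[OF e v(1)] by blast
            obtain T where T: "T \<in> B" "f ` e' = \<phi> T"
              using edge[OF e'(1)] by blast
            \<comment> \<open>The image of \<open>e'\<close> lies in that of \<open>e\<close>
              together with \<open>f v\<close>, and \<open>S\<close> contains both.\<close>
            have "f ` e' \<subseteq> S"
              using e'(3) v S \<phi>(1)[OF S(1)] by auto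
            then have "T = S"
              using \<phi>_eq[OF T(1) S(1)] T(2) by simp
            then have "f ` e' = f ` e"
              using S T by simp
            then have "e' = e"
              using inj_on_image_eq_iff[OF f(1) e_sub[OF e'(1)] e_sub[OF e]] by blast
            then show False
              using e'(2) by blast
          qed
          moreover have "f ` e \<subseteq> S"
            using S \<phi> by auto
          ultimately have "S \<inter> f ` fst H = f ` e"
            using e_sub[OF e] by auto
          then show ?thesis
            using S(1) by (auto simp: B_def)
        qed
        then have "trace_embeds H {..<m} \<A>"
          unfolding trace_embeds_def using f by blast
        then show False
          using free by blast
      qed
      moreover have "\<phi> S \<subseteq> {..<m} \<and> card (\<phi> S) = k" if "S \<in> B" for S
        using \<phi>[OF that] that sub unfolding B_def by blast
      ultimately show ?thesis
        by (auto simp: free_edge_sets_def)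
    qed
    then have "card (\<phi> ` B) \<le> ex k m H"
      by (rule ex_upper[OF H(1)])
    moreover have "inj_on \<phi> B"
      using \<phi>_eq \<phi>(1) by (metis inj_onI)
    ultimately have "card B \<le> ex k m H"
      by (simp add: card_image)
    moreover have "\<A> \<subseteq> ?small \<union> B"
      using sub by (auto simp: B_def)
    then have "card \<A> \<le> card (?small \<union> B)"
      by (rule card_mono[rotated]) (use small sub in \<open>auto simp: B_def intro: finite_subset\<close>)
    moreover have "card (?small \<union> B) \<le> card ?small + card B"
      by (rule card_Un_le)
    ultimately show ?thesis
      using small d by simp
  qed
  show "(\<Sum>i<k. m choose i) + ex k m H \<in> card ` ?X"
  proof -
    obtain E where E: "E \<in> free_edge_sets k m H" "card E = ex k m H"
      using ex_attained[OF H(1,3)] by blast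
    then have E_edge: "\<And>e. e \<in> E \<Longrightarrow> e \<subseteq> {..<m} \<and> card e = k" and free: "\<not> embeds H ({..<m}, E)"
      by (auto simp: free_edge_sets_def)
    have fin: "finite S" if "S \<in> ?small \<union> E" for S
      using that E_edge by (auto intro: finite_subset[of S "{..<m}"])
    have finE: "finite E"
      by (rule finite_subset[of _ "Pow {..<m}"]) (use E_edge in auto)
    \<comment> \<open>Disjoint by cardinality: below \<open>k\<close> against exactly
      \<open>k\<close>.\<close>
    have "card (?small \<union> E) = card ?small + card E"
      by (rule card_Un_disjoint) (use small finE E_edge in auto)
    moreover have "?small \<union> E \<in> ?X"
    proof (intro CollectI conjI ballI impI notI)
      show "?small \<union> E \<subseteq> Pow {..<m}"
        using E_edge by auto
      show "card (S \<inter> T) < k" if ST: "S \<in> ?small \<union> E" "T \<in> ?small \<union> E" "S \<noteq> T" for S T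
      proof (rule ccontr)
        assume "\<not> card (S \<inter> T) < k"
        moreover have "card (S \<inter> T) \<le> card S" "card (S \<inter> T) \<le> card T"
          using fin ST by (auto intro!: card_mono simp del: Un_iff)
        moreover have "card S \<le> k" "card T \<le> k"
          using ST E_edge by fastforce+
        \<comment> \<open>Sets of size at most \<open>k\<close> that share \<open>k\<close> elements
          both coincide with their intersection.\<close>
        ultimately have "card (S \<inter> T) = card S" "card (S \<inter> T) = card T"
          by simp_all
        then have "S \<inter> T = S" "S \<inter> T = T"
          using fin[OF ST(1)] fin[OF ST(2)] by (simp_all add: card_subset_eq)
        then show False
          using ST(3) by blast
      qed
      assume "trace_embeds H {..<m} (?small \<union> E)"
      then obtain f where f: "inj_on f (fst H)" "f ` fst H \<subseteq> {..<m}"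
        and tr: "\<And>e. e \<in> snd H \<Longrightarrow> \<exists>S\<in>?small \<union> E. S \<inter> f ` fst H = f ` e"
        unfolding trace_embeds_def by auto
      \<comment> \<open>The trace has \<open>k\<close> elements, too many for a set in
        \<open>?small\<close>; a member of \<open>E\<close> that contains it has the same size and
        equals it.\<close>
      have "f ` e \<in> E" if e: "e \<in> snd H" for e
      proof -
        obtain S where S: "S \<in> ?small \<union> E" "S \<inter> f ` fst H = f ` e"
          using tr[OF e] by blast
        have "e \<subseteq> fst H" "card e = k"
          using e H by (auto simp: hypergraph_def uniform_def)
        then have card: "card (f ` e) = k"
          using f(1) by (metis card_image inj_on_subset)
        have sub: "f ` e \<subseteq> S"
          using S by blast
        then have "k \<le> card S"
          using card card_mono fin S(1) by metis
        then have "S \<in> E"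
          using S(1) by auto
        moreover have "f ` e = S"
          by (rule card_subset_eq) (use fin S sub card E_edge[OF \<open>S \<in> E\<close>] in auto)
        ultimately show ?thesis
          by simp
      qed
      then have "embeds H ({..<m}, E)"
        unfolding embeds_def using f by auto
      then show False
        using free by blast
    qed
    ultimately show ?thesis
      using small E(2) by (metis (no_types, lifting) imageI)
  qed
qed

section \<open>Finite fields of characteristic two\<close>

lemma CHAR_bit: "CHAR(bit) = 2"
proof (rule CHAR_eqI)
  show "2 dvd n" if "of_nat n = (0 :: bit)" for n
    using that even_of_nat[of n, where ?'a = bit] by simp
qed simp

text \<open>Over an algebraically closed field \<open>p\<close> splits into linear factors, and a
  repeated factor would give a common root of \<open>p\<close> and its derivative. So the multiset
  of roots has no repetitions.\<close>

lemma card_roots_separable: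
  fixes p :: "'a::alg_closed_field poly"
  assumes "p \<noteq> 0" and sep: "\<And>x. poly p x = 0 \<Longrightarrow> poly (pderiv p) x \<noteq> 0"
  shows "card {x. poly p x = 0} = degree p"
proof -
  obtain A where A: "size A = degree p" "p = smult (lead_coeff p) (\<Prod>x\<in>#A. [:-x, 1:])"
    using alg_closed_imp_factorization[OF \<open>p \<noteq> 0\<close>] by blast
  have root_iff: "poly p x = 0 \<longleftrightarrow> x \<in># A" for x
    by (subst A(2)) (use \<open>p \<noteq> 0\<close> in \<open>simp add: poly_prod_mset prod_mset_zero_iff image_iff\<close>)
  have "count A x = 1" if "x \<in># A" for x
  proof (rule ccontr)
    assume "count A x \<noteq> 1"
    with that have "2 \<le> count A x"
      by (metis One_nat_def Suc_1 count_eq_zero_iff leI less_Suc0 less_Suc_eq less_antisym)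
    then have "{#x, x#} \<subseteq># A"
      by (simp add: subseteq_mset_def)
    then obtain B where B: "A = {#x, x#} + B"
      by (metis subset_mset.le_iff_add)
    \<comment> \<open>Two occurrences of \<open>x\<close> among the roots extract the square of its
      linear factor from \<open>p\<close>.\<close>
    define q where "q = smult (lead_coeff p) (\<Prod>x\<in>#B. [:-x, 1:])"
    have p: "p = [:-x, 1:] * ([:-x, 1:] * q)"
      by (subst A(2)) (simp add: B q_def mult_ac)
    have "poly (pderiv p) x = 0"
      unfolding p pderiv_mult by simp
    then show False
      using sep that root_iff by blast
  qed
  then have "A = mset_set (set_mset A)"
    by (intro multiset_eqI) (metis count_mset_set(1,3) finite_set_mset not_in_iff)
  then have "card (set_mset A) = size A"
    by (metis size_mset_set)
  then show ?thesis
    using A(1) root_iff by simp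
qed

text \<open>The witness is the field with \<open>2 ^ n\<close> elements: the fixed points of the \<open>n\<close>-th iterate of
  Frobenius.\<close>

lemma exists_finite_subring:
  obtains S :: "bit alg_closure set" where "finite S" "card S = 2 ^ n"
    "\<And>x y. x \<in> S \<Longrightarrow> y \<in> S \<Longrightarrow> x - y \<in> S" "\<And>x y. x \<in> S \<Longrightarrow> y \<in> S \<Longrightarrow> x * y \<in> S"
proof (cases "n = 0")
  \<comment> \<open>Here \<open>X^q - X\<close> with \<open>q = 1\<close> would be the zero
    polynomial; the set containing only 0 serves instead.\<close>
  case True
  then show thesis
    by (intro that[of "{0}"]) auto
next
  case False
  define q :: nat where "q = 2 ^ n"
  have q: "q \<ge> 2"
    unfolding q_def using False by (metis less_one linorder_not_le self_le_power one_le_numeral neq0_conv power_one_right power_increasing)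
  define p :: "bit alg_closure poly" where "p = monom 1 q - [:0, 1:]"
  have char: "CHAR(bit alg_closure) = 2"
    by (simp add: CHAR_bit)
  have "of_nat q = (0 :: bit alg_closure)"
    unfolding of_nat_eq_0_iff_char_dvd char using False by (simp add: q_def)
  \<comment> \<open>In characteristic 2 the derivative of \<open>X^q - X\<close> is the constant -1,
    so all roots are simple.\<close>
  then have pderiv: "pderiv p = -1"
    by (simp add: p_def pderiv_diff pderiv_monom pderiv_pCons one_pCons)
  have deg: "degree p = q"
    unfolding p_def diff_conv_add_uminus
    by (subst degree_add_eq_left) (use q in \<open>auto simp: degree_monom_eq\<close>)
  have root_iff: "poly p x = 0 \<longleftrightarrow> x ^ q = x" for x
    by (simp add: p_def poly_monom)
  have "p \<noteq> 0"
    using deg q by auto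
  show thesis
  proof (rule that)
    show "finite {x. poly p x = 0}"
      by (rule poly_roots_finite) fact
    have "card {x. poly p x = 0} = degree p"
      by (rule card_roots_separable) (use \<open>p \<noteq> 0\<close> in \<open>simp_all add: pderiv\<close>)
    then show "card {x. poly p x = 0} = 2 ^ n"
      by (simp add: deg q_def)
  next
    fix x y
    assume "x \<in> {x. poly p x = 0}" "y \<in> {x. poly p x = 0}"
    then have xy: "x ^ q = x" "y ^ q = y"
      by (simp_all add: root_iff)
    \<comment> \<open>Since \<open>q\<close> is a power of the characteristic, the
      \<open>q\<close>-th power is additive; in characteristic 2 this covers differences.\<close>
    have "(x + y) ^ q = x ^ q + y ^ q"
      by (rule freshmans_dream'[where n = n]) (simp_all add: char q_def CHAR_bit)
    then show "x - y \<in> {x. poly p x = 0}"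
      by (simp add: root_iff xy minus_CHAR_2 char CHAR_bit)
    show "x * y \<in> {x. poly p x = 0}"
      by (simp add: root_iff xy power_mult_distrib)
  qed
qed

section \<open>Graphs without \<open>K\<^bsub>2,2\<^esub>\<close>\<close>

text \<open>Vertices on opposite sides are distinct because edges have two elements, so distinctness
  is demanded only within each side.\<close>

lemma embeds_K22_iff:
  assumes "\<forall>e\<in>E. e \<subseteq> V \<and> card e = 2"
  shows "embeds (complete_bipartite 2 2) (V, E) \<longleftrightarrow>
    (\<exists>u u' w w'. u \<noteq> u' \<and> w \<noteq> w' \<and> {u, w} \<in> E \<and> {u, w'} \<in> E \<and> {u', w} \<in> E \<and> {u', w'} \<in> E)"
    (is "_ = ?R")
proof
  assume "embeds (complete_bipartite 2 2) (V, E)"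
  then obtain f where inj: "inj_on f (fst (complete_bipartite 2 2))"
    and E: "\<forall>e\<in>snd (complete_bipartite 2 2). f ` e \<in> E"
    unfolding embeds_def by auto
  have "f (Inl 0) \<noteq> f (Inl 1)" "f (Inr 0) \<noteq> f (Inr 1)"
    using inj by (simp_all add: K22_simps)
  moreover have "{f (Inl i), f (Inr j)} \<in> E" if "i \<in> {0, 1}" "j \<in> {0, 1}" for i j
    using E that by (auto simp: K22_simps)
  ultimately show ?R
    by (intro exI[of _ "f (Inl 0)"] exI[of _ "f (Inl 1)"] exI[of _ "f (Inr 0)"] exI[of _ "f (Inr 1)"]) simp
next
  assume ?R
  then obtain u u' w w' where ne: "u \<noteq> u'" "w \<noteq> w'"
    and E: "{u, w} \<in> E" "{u, w'} \<in> E" "{u', w} \<in> E" "{u', w'} \<in> E"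
    by blast
  have ne': "u \<noteq> w" "u \<noteq> w'" "u' \<noteq> w" "u' \<noteq> w'"
    using bspec[OF assms E(1)] bspec[OF assms E(2)] bspec[OF assms E(3)] bspec[OF assms E(4)] by auto
  have V: "u \<in> V" "u' \<in> V" "w \<in> V" "w' \<in> V"
    using bspec[OF assms E(1)] bspec[OF assms E(4)] by auto
  define f :: "nat + nat \<Rightarrow> 'a"
    where "f = case_sum (\<lambda>i. if i = 0 then u else u') (\<lambda>j. if j = 0 then w else w')"
  have "inj_on f (fst (complete_bipartite 2 2))"
    using ne ne' by (simp add: K22_simps f_def)
  moreover have "f ` fst (complete_bipartite 2 2) \<subseteq> V"
    using V by (simp add: K22_simps f_def)
  moreover have "\<forall>e\<in>snd (complete_bipartite 2 2). f ` e \<in> E"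
    using E by (simp add: K22_simps f_def)
  ultimately show "embeds (complete_bipartite 2 2) (V, E)"
    unfolding embeds_def by auto
qed

text \<open>Every edge has at least one and at most two orientations. Arcs are convenient because
  the degrees sum to their number and the polarity graph is enumerated by them.\<close>

lemma card_arcs:
  assumes "finite E" "\<And>e. e \<in> E \<Longrightarrow> card e = 2"
  shows "card E \<le> card {(u, w). {u, w} \<in> E}" "card {(u, w). {u, w} \<in> E} \<le> 2 * card E"
    "finite {(u, w). {u, w} \<in> E}"
proof -
  let ?R = "{(u, w). {u, w} \<in> E}"
  have fin: "finite e" if "e \<in> E" for e
    using assms(2)[OF that] by (simp add: card_ge_0_finite)
  have "?R \<subseteq> (\<Union>E) \<times> (\<Union>E)"
    by blast
  then show finR: "finite ?R"
    by (rule finite_subset) (use assms(1) fin in auto)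
  have "E \<subseteq> (\<lambda>(u, w). {u, w}) ` ?R"
  proof
    fix e assume "e \<in> E"
    then obtain u w where "e = {u, w}"
      using assms(2) by (metis card_2_iff)
    then show "e \<in> (\<lambda>(u, w). {u, w}) ` ?R"
      using \<open>e \<in> E\<close> by (intro image_eqI[of _ _ "(u, w)"]) auto
  qed
  then show "card E \<le> card ?R"
    using finR surj_card_le by blast
  have "?R \<subseteq> (\<Union>e\<in>E. {(u, w). u \<noteq> w \<and> e = {u, w}})"
    using assms(2) by force
  then have "card ?R \<le> card (\<Union>e\<in>E. {(u, w). u \<noteq> w \<and> e = {u, w}})"
  proof (rule card_mono[rotated])
    show "finite (\<Union>e\<in>E. {(u, w). u \<noteq> w \<and> e = {u, w}})"
    proof (rule finite_UN_I[OF assms(1)])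
      fix e assume "e \<in> E"
      have "{(u, w). u \<noteq> w \<and> e = {u, w}} \<subseteq> e \<times> e"
        by auto
      then show "finite {(u, w). u \<noteq> w \<and> e = {u, w}}"
        by (rule finite_subset) (simp add: fin[OF \<open>e \<in> E\<close>])
    qed
  qed
  also have "\<dots> \<le> (\<Sum>e\<in>E. card {(u, w). u \<noteq> w \<and> e = {u, w}})"
    by (rule card_UN_le) fact
  also have "\<dots> \<le> (\<Sum>e\<in>E. 2)"
  proof (rule sum_mono)
    fix e assume "e \<in> E"
    then obtain u w where e: "e = {u, w}"
      using assms(2) by (metis card_2_iff)
    have "{(u', w'). u' \<noteq> w' \<and> e = {u', w'}} \<subseteq> {(u, w), (w, u)}"
      by (auto simp: e doubleton_eq_iff)
    then have "card {(u', w'). u' \<noteq> w' \<and> e = {u', w'}} \<le> card {(u, w), (w, u)}"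
      by (rule card_mono[rotated]) simp
    also have "\<dots> \<le> 2"
      using card_length[of "[(u, w), (w, u)]"] by simp
    finally show "card {(u', w'). u' \<noteq> w' \<and> e = {u', w'}} \<le> 2" .
  qed
  finally show "card ?R \<le> 2 * card E"
    by simp
qed

text \<open>Cherries \<open>u - v - w\<close> are counted by their middle vertex and by their pair of ends,
  which has at most one common neighbour when \<open>u \<noteq> w\<close>.\<close>

lemma K22_free_arcs_bound:
  fixes E :: "nat set set"
  assumes E: "E \<in> free_edge_sets 2 m (complete_bipartite 2 2)"
  defines "r \<equiv> card {(u, w). {u, w} \<in> E}"
  shows "r\<^sup>2 \<le> m * (r + m\<^sup>2)"
proof -
  have edge: "\<And>e. e \<in> E \<Longrightarrow> e \<subseteq> {..<m} \<and> card e = 2"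
    and free: "\<not> embeds (complete_bipartite 2 2) ({..<m}, E)"
    using E by (auto simp: free_edge_sets_def)
  have edges: "\<forall>e\<in>E. e \<subseteq> {..<m} \<and> card e = 2"
    using edge by blast
  define N where "N v = {u. {v, u} \<in> E}" for v
  have N: "N v \<subseteq> {..<m}" for v
    using edge by (fastforce simp: N_def)
  have finN: "finite (N v)" for v
    using N finite_subset by blast
  have "{(u, w). {u, w} \<in> E} = Sigma {..<m} N"
    using edge by (fastforce simp: N_def)
  then have r: "r = (\<Sum>v<m. card (N v))" "r = card (Sigma {..<m} N)"
    by (simp_all add: r_def finN)
  \<comment> \<open>\<open>?T\<close> collects the cherries with middle vertex \<open>v\<close>,
    \<open>?D\<close> the degenerate ones with equal ends.\<close>
  let ?T = "SIGMA v:{..<m}. N v \<times> N v"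
  let ?D = "(\<lambda>(v, u). (v, u, u)) ` Sigma {..<m} N"
  have sumsq: "card ?T = (\<Sum>v<m. (card (N v))\<^sup>2)"
    by (simp add: finN card_cartesian_product power2_eq_square)
  have common: "v = v'" if "u \<noteq> w" "u \<in> N v" "w \<in> N v" "u \<in> N v'" "w \<in> N v'" for u w v v'
    using that free unfolding N_def embeds_K22_iff[OF edges] by blast
  \<comment> \<open>Outside \<open>?D\<close> the ends determine the middle vertex, so forgetting it
    is injective.\<close>
  have "card (?T - ?D) \<le> card ({..<m} \<times> {..<m})"
  proof (rule card_inj_on_le[where f = snd])
    show "inj_on snd (?T - ?D)"
    proof (rule inj_onI)
      fix s t assume st: "s \<in> ?T - ?D" "t \<in> ?T - ?D" "snd s = snd t"
      obtain v u w v' where eq: "s = (v, u, w)" "t = (v', u, w)"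
        using st(3) by (metis prod.collapse)
      then have N: "v < m" "u \<in> N v" "w \<in> N v" "u \<in> N v'" "w \<in> N v'"
        using st by auto
      have "u \<noteq> w"
      proof
        assume "u = w"
        then have "s \<in> ?D"
          using eq N by (intro image_eqI[of _ _ "(v, u)"]) auto
        then show False
          using st(1) by blast
      qed
      then show "s = t"
        using common N eq by blast
    qed
    show "snd ` (?T - ?D) \<subseteq> {..<m} \<times> {..<m}"
      using N by fastforce
  qed simp
  moreover have "card ?D \<le> r"
    unfolding r(2) by (rule card_image_le) (simp add: finN)
  moreover have "card ?T \<le> card (?D \<union> (?T - ?D))"
    by (rule card_mono) (auto simp: finN)
  moreover have "card (?D \<union> (?T - ?D)) \<le> card ?D + card (?T - ?D)"
    by (rule card_Un_le)
  ultimately have T: "card ?T \<le> r + m\<^sup>2"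
    by (simp add: power2_eq_square)
  \<comment> \<open>Cauchy-Schwarz for the degree sum.\<close>
  have "(\<Sum>v<m. real (card (N v)))\<^sup>2 \<le> (\<Sum>v<m. (real (card (N v)))\<^sup>2) * card {..<m}"
    by (rule sum_squared_le_sum_of_squares)
  then have "real (r\<^sup>2) \<le> real (card ?T * m)"
    unfolding r(1) sumsq by simp
  then have "r\<^sup>2 \<le> card ?T * m"
    by (simp only: of_nat_le_iff)
  also have "\<dots> \<le> (r + m\<^sup>2) * m"
    using T by (rule mult_le_mono1)
  finally show ?thesis
    by (simp only: mult.commute)
qed

text \<open>With \<open>y = m^(3/2)\<close>, the arc bound \<open>r^2 <= m r + m^3\<close> gives
  \<open>r^2 <= y r + y^2\<close> because \<open>m <= y\<close>, and this forces
  \<open>r <= 2 y\<close>.\<close>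

lemma ex_K22_upper: "real (ex_graph m (complete_bipartite 2 2)) \<le> 2 * real m powr (3/2)"
proof (cases "m = 0")
  \<comment> \<open>Both sides are zero: \<open>0 powr (3/2) = 0\<close>, and the empty vertex set
    contains no edge of size 2.\<close>
  case True
  obtain E where E: "E \<in> free_edge_sets 2 m (complete_bipartite 2 2)"
    "card E = ex_graph m (complete_bipartite 2 2)"
    using ex_attained[OF hypergraph_complete_bipartite, of 2 2] by (auto simp: K22_simps)
  then have "E = {}"
    using True by (auto simp: free_edge_sets_def)
  then show ?thesis
    using E True by simp
next
  case False
  obtain E where E: "E \<in> free_edge_sets 2 m (complete_bipartite 2 2)"
    "card E = ex_graph m (complete_bipartite 2 2)"
    using ex_attained[OF hypergraph_complete_bipartite, of 2 2] by (auto simp: K22_simps)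
  then have edge: "\<And>e. e \<in> E \<Longrightarrow> e \<subseteq> {..<m} \<and> card e = 2"
    by (auto simp: free_edge_sets_def)
  have "finite E"
    by (rule finite_subset[of _ "Pow {..<m}"]) (use edge in auto)
  define r where "r = card {(u, w). {u, w} \<in> E}"
  define y where "y = real m powr (3/2)"
  have y: "y\<^sup>2 = real m ^ 3" "real m \<le> y"
  proof -
    have "y\<^sup>2 = real m powr (3/2 + 3/2)"
      unfolding powr_add y_def power2_eq_square ..
    then show "y\<^sup>2 = real m ^ 3"
      using False by (simp add: powr_numeral)
    have "real m powr 1 \<le> real m powr (3/2)"
      using False by (intro powr_mono) auto
    then show "real m \<le> y"
      by (simp add: y_def)
  qed
  have "real (r\<^sup>2) \<le> real (m * (r + m\<^sup>2))"
    using K22_free_arcs_bound[OF E(1)] unfolding r_def of_nat_le_iff .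
  then have "(real r)\<^sup>2 \<le> real m * real r + y\<^sup>2"
    unfolding y(1) by (simp add: algebra_simps power2_eq_square power3_eq_cube)
  also have "\<dots> \<le> y * real r + y\<^sup>2"
    using y(2) by (simp add: mult_right_mono)
  finally have le: "(real r)\<^sup>2 \<le> y * real r + y\<^sup>2" .
  have "real r \<le> 2 * y"
  proof (rule ccontr)
    assume "\<not> real r \<le> 2 * y"
    moreover have "0 < y"
      using False y(2) by simp
    \<comment> \<open>The positive expression equals \<open>r^2 - y r - y^2\<close>, which
      contradicts \<open>le\<close>.\<close>
    ultimately have "0 < (real r - 2 * y) * (real r + y) + y\<^sup>2"
      by (intro add_pos_pos mult_pos_pos) auto
    then show False
      using le by (simp add: algebra_simps power2_eq_square)
  qed
  moreover have "card E \<le> r"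
    unfolding r_def by (rule card_arcs) (use \<open>finite E\<close> edge in auto)
  ultimately show ?thesis
    using E(2) by (simp add: y_def)
qed

text \<open>The witness is the polarity graph of an affine plane: the vertices are the points of the plane
  over the field with \<open>2 ^ n\<close> elements, and \<open>(x, y)\<close> is joined to \<open>(a, b)\<close> when it lies on the
  line \<open>y = a x - b\<close>. Two points lie on at most one common line.\<close>

lemma ex_K22_lower:
  assumes "4 ^ n \<le> m"
  shows "4 ^ n * (2 ^ n - 1) \<le> 2 * ex_graph m (complete_bipartite 2 2)"
proof -
  obtain S :: "bit alg_closure set" where S: "finite S" "card S = 2 ^ n"
    and diff: "\<And>x y. x \<in> S \<Longrightarrow> y \<in> S \<Longrightarrow> x - y \<in> S"
    and mult: "\<And>x y. x \<in> S \<Longrightarrow> y \<in> S \<Longrightarrow> x * y \<in> S"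
    using exists_finite_subring by blast
  have q2: "(2::nat) ^ n * 2 ^ n = 4 ^ n"
    by (simp add: power_mult_distrib[symmetric])
  then have "card (S \<times> S) \<le> card {..<m}"
    using S assms by (simp add: card_cartesian_product)
  \<comment> \<open>The \<open>4 ^ n\<close> points of the plane are placed among the
    \<open>m\<close> vertices; the other vertices stay isolated.\<close>
  then obtain \<phi> where \<phi>: "inj_on \<phi> (S \<times> S)" "\<phi> ` (S \<times> S) \<subseteq> {..<m}"
    using card_le_inj[of "S \<times> S" "{..<m}"] S by auto
  \<comment> \<open>The incidence equation is symmetric in the two points;
    \<open>p \<noteq> p'\<close> discards the loops at points on their own line.\<close>
  define adj where "adj p p' \<longleftrightarrow> p \<in> S \<times> S \<and> p' \<in> S \<times> S \<and> p \<noteq> p' \<and> snd p + snd p' = fst p * fst p'" for p p'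
  define E where "E = {{\<phi> p, \<phi> p'} |p p'. adj p p'}"
  have adj_sym: "adj p p' \<Longrightarrow> adj p' p" for p p'
    by (metis adj_def add.commute mult.commute)
  have adjD: "\<exists>p p'. u = \<phi> p \<and> w = \<phi> p' \<and> adj p p'" if uw: "{u, w} \<in> E" for u w
  proof -
    obtain p p' where p: "{u, w} = {\<phi> p, \<phi> p'}" "adj p p'"
      using uw unfolding E_def by blast
    then consider "u = \<phi> p" "w = \<phi> p'" | "u = \<phi> p'" "w = \<phi> p"
      by (auto simp: doubleton_eq_iff)
    then show ?thesis
      using p(2) adj_sym[OF p(2)] by cases blast+
  qed
  have edge: "e \<subseteq> {..<m} \<and> card e = 2" if e: "e \<in> E" for e
  proof -
    obtain p p' where p: "e = {\<phi> p, \<phi> p'}" "adj p p'"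
      using e unfolding E_def by blast
    then have "\<phi> p \<noteq> \<phi> p'"
      using \<phi>(1) by (auto simp: adj_def inj_on_def)
    then show ?thesis
      using p \<phi>(2) by (auto simp: adj_def)
  qed
  have finE: "finite E"
    by (rule finite_subset[of _ "Pow {..<m}"]) (use edge in auto)
  have edges: "\<forall>e\<in>E. e \<subseteq> {..<m} \<and> card e = 2"
    using edge by blast
  have "\<not> embeds (complete_bipartite 2 2) ({..<m}, E)"
  proof
    assume "embeds (complete_bipartite 2 2) ({..<m}, E)"
    then obtain u u' w w' where ne: "u \<noteq> u'" "w \<noteq> w'"
      and uw: "{u, w} \<in> E" "{u, w'} \<in> E" "{u', w} \<in> E" "{u', w'} \<in> E"
      unfolding embeds_K22_iff[OF edges] by (elim exE conjE)
    obtain p1 q1 where 1: "u = \<phi> p1" "w = \<phi> q1" "adj p1 q1"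
      using adjD[OF uw(1)] by blast
    obtain p2 q2 where 2: "u' = \<phi> p2" "w' = \<phi> q2" "adj p2 q2"
      using adjD[OF uw(4)] by blast
    have eqI: "p = p'" if "\<phi> p = \<phi> p'" "p \<in> S \<times> S" "p' \<in> S \<times> S" for p p'
      using that \<phi>(1) by (simp add: inj_on_eq_iff)
    have 3: "adj p1 q2"
      using adjD[OF uw(2)] 1 2 eqI unfolding adj_def by metis
    have 4: "adj p2 q1"
      using adjD[OF uw(3)] 1 2 eqI unfolding adj_def by metis
    obtain x1 y1 x2 y2 a1 b1 a2 b2 where pq: "p1 = (x1, y1)" "p2 = (x2, y2)" "q1 = (a1, b1)" "q2 = (a2, b2)"
      by (cases p1; cases p2; cases q1; cases q2) blast
    have eqs: "y1 + b1 = x1 * a1" "y2 + b2 = x2 * a2" "y1 + b2 = x1 * a2" "y2 + b1 = x2 * a1"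
      using 1(3) 2(3) 3 4 by (simp_all add: adj_def pq)
    \<comment> \<open>The four incidences cancel in this product, so on one side the abscissae
      agree, and then the ordinates agree as well.\<close>
    have "(x1 - x2) * (a1 - a2) = x1 * a1 - x1 * a2 - x2 * a1 + x2 * a2"
      by (simp add: algebra_simps)
    also have "\<dots> = 0"
      unfolding eqs[symmetric] by simp
    finally consider "x1 = x2" | "a1 = a2"
      by auto
    then show False
    proof cases
      case 1
      then have "y1 = y2"
        using eqs by (metis add_right_cancel)
      then show False
        using 1 ne \<open>u = \<phi> p1\<close> \<open>u' = \<phi> p2\<close> pq by simp
    next
      case 2
      then have "b1 = b2"
        using eqs by (metis add_left_cancel)
      then show False
        using 2 ne \<open>w = \<phi> q1\<close> \<open>w' = \<phi> q2\<close> pq by simp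
    qed
  qed
  then have free: "E \<in> free_edge_sets 2 m (complete_bipartite 2 2)"
    using edge by (simp add: free_edge_sets_def)
  \<comment> \<open>A point and an abscissa other than its own determine one neighbour; the
    restriction on the abscissa keeps the neighbour different from the point.\<close>
  let ?T = "SIGMA p:S \<times> S. S - {fst p}"
  have "4 ^ n * (2 ^ n - 1) = card ?T"
  proof -
    have "card ?T = (\<Sum>p\<in>S \<times> S. card (S - {fst p}))"
      by (rule card_SigmaI) (use S in auto)
    also have "\<dots> = (\<Sum>p\<in>S \<times> S. 2 ^ n - 1)"
      by (rule sum.cong) (use S in \<open>auto simp: card_Diff_singleton\<close>)
    finally show ?thesis
      by (simp add: card_cartesian_product S q2)
  qed
  also have "\<dots> \<le> card {(u, w). {u, w} \<in> E}"
  proof (rule card_inj_on_le[where f = "\<lambda>(p, a). (\<phi> p, \<phi> (a, fst p * a - snd p))"])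
    show "inj_on (\<lambda>(p, a). (\<phi> p, \<phi> (a, fst p * a - snd p))) ?T"
    proof (rule inj_onI)
      fix s t
      assume st: "s \<in> ?T" "t \<in> ?T"
        and im: "(\<lambda>(p, a). (\<phi> p, \<phi> (a, fst p * a - snd p))) s = (\<lambda>(p, a). (\<phi> p, \<phi> (a, fst p * a - snd p))) t"
      obtain x y a x' y' a' where eq_st: "s = ((x, y), a)" "t = ((x', y'), a')"
        by (metis prod.collapse)
      have S': "x \<in> S" "y \<in> S" "a \<in> S" "x' \<in> S" "y' \<in> S" "a' \<in> S"
        and eq: "\<phi> (x, y) = \<phi> (x', y')" "\<phi> (a, x * a - y) = \<phi> (a', x' * a' - y')"
        using st im by (simp_all add: eq_st)
      have "(x, y) = (x', y')" "(a, x * a - y) = (a', x' * a' - y')"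
        using eq S' diff mult by (auto dest!: inj_onD[OF \<phi>(1)])
      then show "s = t"
        by (simp add: eq_st)
    qed
    show "(\<lambda>(p, a). (\<phi> p, \<phi> (a, fst p * a - snd p))) ` ?T \<subseteq> {(u, w). {u, w} \<in> E}"
    proof (rule image_subsetI)
      fix t assume t: "t \<in> ?T"
      obtain x y a where eq_t: "t = ((x, y), a)"
        by (metis prod.collapse)
      have "adj (x, y) (a, x * a - y)"
        using t by (auto simp: adj_def diff mult eq_t)
      then show "(\<lambda>(p, a). (\<phi> p, \<phi> (a, fst p * a - snd p))) t \<in> {(u, w). {u, w} \<in> E}"
        unfolding E_def eq_t by auto
    qed
    show "finite {(u, w). {u, w} \<in> E}"
      by (rule card_arcs) (use finE edge in auto)
  qed
  also have "\<dots> \<le> 2 * card E"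
    by (rule card_arcs) (use finE edge in auto)
  also have "\<dots> \<le> 2 * ex_graph m (complete_bipartite 2 2)"
    using ex_upper[OF hypergraph_complete_bipartite free] by simp
  finally show ?thesis .
qed

text \<open>Let \<open>4 ^ n\<close> be the largest power of 4 up to \<open>m\<close> and
  \<open>q = 2 ^ n\<close>. Then \<open>m < (2 q)^2\<close>, so \<open>m^(3/2) <= 8 q^3\<close>,
  which the polarity graph matches up to a constant.\<close>

lemma ex_K22_lower_powr:
  assumes "4 \<le> m"
  shows "real m powr (3/2) \<le> 32 * real (ex_graph m (complete_bipartite 2 2))"
proof -
  obtain n where n: "4 ^ n \<le> m" "m < 4 ^ (n + 1)"
    using ex_power_ivl1[of 4 m] assms by auto
  \<comment> \<open>This gives \<open>q >= 2\<close>, hence \<open>q - 1 >= q / 2\<close>.\<close>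
  then have "n \<noteq> 0"
    using assms by (auto intro!: Nat.gr0I)
  define q :: real where "q = 2 ^ n"
  have "q \<ge> 2"
    unfolding q_def using \<open>n \<noteq> 0\<close> power_increasing[of 1 n "2::real"] by simp
  have q2: "4 ^ n = q\<^sup>2"
    unfolding q_def power2_eq_square power_mult_distrib[symmetric] by simp
  have "real m \<le> (2 * q)\<^sup>2"
    using n(2) q2 by (simp add: power_mult_distrib flip: of_nat_less_iff[where ?'a = real])
  then have "real m powr (3/2) \<le> ((2 * q)\<^sup>2) powr (3/2)"
    by (intro powr_mono2) auto
  also have "\<dots> = (2 * q) ^ 3"
  proof -
    have "(2 * q)\<^sup>2 = (2 * q) powr 2" "(2 * q) powr 3 = (2 * q) ^ 3"
      using \<open>q \<ge> 2\<close> by (simp_all add: powr_numeral)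
    then show ?thesis
      by (simp only: powr_powr) simp
  qed
  \<comment> \<open>By \<open>q >= 2\<close>, \<open>8 q^3\<close> is at most
    \<open>16 q^2 (q - 1)\<close>; the factor two between arcs and edges then makes 32.\<close>
  also have "\<dots> \<le> 16 * (q\<^sup>2 * (q - 1))"
  proof -
    have "2 * (q * q) \<le> q * (q * q)"
      using \<open>q \<ge> 2\<close> by (rule mult_right_mono) simp
    moreover have "(2 * q) ^ 3 = 8 * (q * (q * q))" "16 * (q\<^sup>2 * (q - 1)) = 16 * (q * (q * q)) - 16 * (q * q)"
      by (simp_all add: power2_eq_square power3_eq_cube algebra_simps)
    ultimately show ?thesis
      by linarith
  qed
  also have "q\<^sup>2 * (q - 1) = real (4 ^ n * (2 ^ n - 1))"
  proof -
    have "real (2 ^ n - 1) = q - 1"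
      by (simp add: q_def of_nat_diff)
    then show ?thesis
      by (simp only: of_nat_mult of_nat_power of_nat_numeral q2)
  qed
  also have "\<dots> \<le> real (2 * ex_graph m (complete_bipartite 2 2))"
    using ex_K22_lower[OF n(1)] unfolding of_nat_le_iff .
  finally show ?thesis
    by simp
qed

section \<open>The two formulas and the order of magnitude\<close>

theorem corollary5p5:
  shows "(\<forall>(k::nat) (s::nat list) (m::nat).
            k \<ge> 1 \<and> length s = k \<and> (\<forall>i<k. s ! i > 0) \<longrightarrow>
            forb m {ones_mat k 2, prod_mats (map (\<lambda>n. 1\<^sub>m n) s)} =
              (\<Sum>i<k. m choose i) + ex k m (complete_partite s)) \<and>
         (\<forall>m::nat. forb m {ones_mat 2 2, F11} = 1 + m + ex_graph m (complete_bipartite 2 2)) \<and>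
         (\<lambda>m::nat. real (forb m {ones_mat 2 2, F11})) \<in> \<Theta>(\<lambda>m. real m powr (3/2))"
proof (intro conjI)
  show "\<forall>(k::nat) (s::nat list) (m::nat).
            k \<ge> 1 \<and> length s = k \<and> (\<forall>i<k. s ! i > 0) \<longrightarrow>
            forb m {ones_mat k 2, prod_mats (map (\<lambda>n. 1\<^sub>m n) s)} =
              (\<Sum>i<k. m choose i) + ex k m (complete_partite s)"
    using forb_eq_binomials_plus_ex[OF hypergraph_complete_partite uniform_complete_partite
        complete_partite_has_edge incidence_prod_mats complete_partite_exchange] by blast
  show forb: "\<forall>m::nat. forb m {ones_mat 2 2, F11} = 1 + m + ex_graph m (complete_bipartite 2 2)"
  proof
    fix m :: nat
    \<comment> \<open>\<open>F11\<close> is treated directly as an incidence matrix of the bipartite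
      graph; for \<open>k = 2\<close> the binomials sum to \<open>1 + m\<close>.\<close>
    have "forb m {ones_mat 2 2, F11} = (\<Sum>i<2. m choose i) + ex_graph m (complete_bipartite 2 2)"
      by (rule forb_eq_binomials_plus_ex[OF hypergraph_complete_bipartite uniform_complete_bipartite
            _ incidence_F11 complete_bipartite_exchange]) (simp_all add: K22_simps)
    then show "forb m {ones_mat 2 2, F11} = 1 + m + ex_graph m (complete_bipartite 2 2)"
      by (simp add: lessThan_2)
  qed
  show "(\<lambda>m::nat. real (forb m {ones_mat 2 2, F11})) \<in> \<Theta>(\<lambda>m. real m powr (3/2))"
  proof (rule bigthetaI)
    show "(\<lambda>m. real (forb m {ones_mat 2 2, F11})) \<in> O(\<lambda>m. real m powr (3/2))"
    \<comment> \<open>The constant 4 collects \<open>1 + m <= 2 m^(3/2)\<close> for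
      \<open>m >= 1\<close> and the bound \<open>2 m^(3/2)\<close> on \<open>ex\<close>.\<close>
    proof (rule bigoI[of _ 4], rule eventually_mono[OF eventually_ge_at_top[of 1]])
      fix m :: nat assume m: "1 \<le> m"
      then have "real m powr 1 \<le> real m powr (3/2)"
        by (intro powr_mono) auto
      then have "real (1 + m) \<le> 2 * real m powr (3/2)"
        using m by simp
      then show "norm (real (forb m {ones_mat 2 2, F11})) \<le> 4 * norm (real m powr (3/2))"
        using ex_K22_upper[of m] forb by simp
    qed
    show "(\<lambda>m. real (forb m {ones_mat 2 2, F11})) \<in> \<Omega>(\<lambda>m. real m powr (3/2))"
    \<comment> \<open>Dropping \<open>1 + m\<close> leaves \<open>ex\<close>; the constant and the
      threshold 4 come from \<open>ex_K22_lower_powr\<close>.\<close>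
    proof (rule landau_omega.bigI[of "1 / 32"], simp, rule eventually_mono[OF eventually_ge_at_top[of 4]])
      fix m :: nat assume "4 \<le> m"
      then show "1 / 32 * norm (real m powr (3/2)) \<le> norm (real (forb m {ones_mat 2 2, F11}))"
        using ex_K22_lower_powr[of m] forb by simp
    qed
  qed
qed

end
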